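(* Let $k\in L^1_{loc}(\mathbb{R}_+)$ be a nonnegative function whose Laplace transform $\widehat k(s)$ exists for all $s>0$, is a Stieltjes function, and satisfies $\widehat{k}(s)\to 0$, $s\widehat{k}(s)\to \infty$ as $s\to \infty$ and $\widehat{k}(s)\to \infty$, $s\widehat{k}(s)\to 0$ as $s\to 0$. Let $\Omega\subset\mathbb{R}^d$ be a bounded domain with sufficiently smooth boundary $\partial\Omega$, let $T>0$, and let $q\in C[0,T]$ be a known function satisfying $q(t)\ge q_0>0$ for all $t\in[0,T]$. Consider the inverse source problem of determining $f(x)$ and $u(x,t)$ such that $$\mathbb{D}_{(k)}u(x,t)=\Delta u(x,t)+f(x)q(t),\quad x\in\Omega,\ t\in(0,T),$$ $$u(x,t)=0,\ x\in\partial\Omega,\ t\in(0,T);\qquad u(x,0)=0,\ x\in\Omega,$$ and $$u(x,T)=h(x),\quad x\in\overline{\Omega}.$$ Set $Q_n(T)=\int_0^T v(T-\tau;\lambda_n)q(\tau)\,d\tau$, $n\in\mathbb{N}$, and let $\underline{C}>0$ be a constant, independent of $n$, such that $Q_n(T)\ge \underline{C}/\lambda_n$ for all $n\in\mathbb{N}$ (such a constant exists). Then the following conditional stability result holds: if $\|f\|_{H^2(\Omega)}\le E$, then $$\|f\|_{L^2(\Omega)}\le \underline{C}^{-1/2}E^{1/2}\|h\|_{L^2(\Omega)}^{1/2}.$$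
   Context: Here $\widehat{f}(s)=\int_0^\infty e^{-st}f(t)\,dt$ denotes the Laplace transform and $\mathbb{R}_+$ the positive half-line. The operator $\mathbb{D}_{(k)}$ acts in the time variable: $(\mathbb{D}_{(k)} w)(t)=\frac{d}{dt}\int_0^t k(t-\tau)w(\tau)\,d\tau-k(t)w(0)$, $t>0$. A function $f$ on $(0,\infty)$ is completely monotone if it is infinitely differentiable and $(-1)^n f^{(n)}(t)\ge 0$ for all $n=0,1,\dots$ and $t>0$. A function $\varphi$ on $(0,\infty)$ is a Stieltjes function if $\varphi(s)=\frac{a}{s}+b+\int_0^\infty e^{-s\tau}\psi(\tau)\,d\tau$ for some $a,b\ge 0$ and some completely monotone $\psi$ whose Laplace transform exists for all $s>0$. $H_0^1(\Omega)$ and $H^2(\Omega)$ denote Sobolev spaces. The Laplace operator $\Delta$ (acting on the space variables) is taken in $L^2(\Omega)$ with domain $D(\Delta)=H_0^1(\Omega)\cap H^2(\Omega)$; its eigensystem is $\{-\lambda_n,\varphi_n\}_{n=1}^\infty$, where $0<\lambda_1\le\lambda_2\le\dots$, $\lambda_n\to\infty$ as $n\to\infty$, and $\{\varphi_n\}_{n=1}^\infty$ is an orthonormal basis of $L^2(\Omega)$; $(\cdot,\cdot)$ is the inner product of $L^2(\Omega)$. For $\lambda>0$, $v(t;\lambda)$, $t>0$, is the impulse-response solution of the relaxation equation $(\mathbb{D}_{(k)}w)(t)+\lambda w(t)=F(t)$, that is, the function with Laplace transform $\widehat v(s;\lambda)=\frac{1}{s\widehat k(s)+\lambda}$. The solution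 $u$ of the initial-boundary-value problem with zero initial value and source $f(x)q(t)$ is represented by the formal eigenfunction expansion $$u(x,t)=\sum_{n=1}^\infty f_n\left(\int_0^t v(t-\tau;\lambda_n)q(\tau)\,d\tau\right)\varphi_n(x),\qquad f_n=(f,\varphi_n).$$
   Formalization: The source f is required to lie in D(Δ)=H_0^1∩H^2 (for f=1 on (0,π), q=1, T large the estimate fails), and the H^2 norm is the sum of the L^2 norms of all weak derivatives of order ≤2 (with the root of the sum of squares it fails on small discs). *)

theory Defs
  imports "HOL-Analysis.Analysis" "HOL-Library.Multiset"
begin

section \<open>Functions of time\<close>

definition loc_integrable :: "(real \<Rightarrow> real) \<Rightarrow> bool" where
  "loc_integrable f \<longleftrightarrow> (\<forall>b>0. set_integrable lebesgue {0<..b} f)"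

definition laplace_exists :: "(real \<Rightarrow> real) \<Rightarrow> real \<Rightarrow> bool" where
  "laplace_exists f s \<longleftrightarrow> set_integrable lebesgue {0<..} (\<lambda>t. exp (- s * t) * f t)"

definition laplace :: "(real \<Rightarrow> real) \<Rightarrow> real \<Rightarrow> real" where
  "laplace f s = (LINT t:{0<..}|lebesgue. exp (- s * t) * f t)"

definition completely_monotone :: "(real \<Rightarrow> real) \<Rightarrow> bool" where
  "completely_monotone f \<longleftrightarrow>
     (\<forall>n. \<forall>t>0. (deriv ^^ n) f differentiable (at t) \<and> (-1) ^ n * (deriv ^^ n) f t \<ge> 0)"

definition stieltjes :: "(real \<Rightarrow> real) \<Rightarrow> bool" where
  "stieltjes \<phi> \<longleftrightarrow>
     (\<exists>a\<ge>0. \<exists>b\<ge>0. \<exists>\<psi>. completely_monotone \<psi> \<and> (\<forall>s>0. laplace_exists \<psi> s) \<and>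
        (\<forall>s>0. \<phi> s = a / s + b + laplace \<psi> s))"

definition admissible_kernel :: "(real \<Rightarrow> real) \<Rightarrow> bool" where
  "admissible_kernel k \<longleftrightarrow>
     loc_integrable k \<and> (\<forall>t>0. k t \<ge> 0) \<and>
     (\<forall>s>0. laplace_exists k s) \<and> stieltjes (laplace k) \<and>
     (laplace k \<longlongrightarrow> 0) at_top \<and> filterlim (\<lambda>s. s * laplace k s) at_top at_top \<and>
     filterlim (laplace k) at_top (at_right 0) \<and> ((\<lambda>s. s * laplace k s) \<longlongrightarrow> 0) (at_right 0)"

definition convol :: "(real \<Rightarrow> real) \<Rightarrow> (real \<Rightarrow> real) \<Rightarrow> real \<Rightarrow> real" where
  "convol k w t = (LINT \<tau>:{0..t}|lebesgue. k (t - \<tau>) * w \<tau>)"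

text \<open>Meaningful only where \<open>convol k w\<close> is differentiable; this is required separately
  in the notion of solution below.\<close>

definition gen_deriv :: "(real \<Rightarrow> real) \<Rightarrow> (real \<Rightarrow> real) \<Rightarrow> real \<Rightarrow> real" where
  "gen_deriv k w t = deriv (convol k w) t - k t * w 0"

definition impulse_response :: "(real \<Rightarrow> real) \<Rightarrow> (real \<Rightarrow> real \<Rightarrow> real) \<Rightarrow> bool" where
  "impulse_response k v \<longleftrightarrow>
     (\<forall>lam>0. \<forall>s>0. laplace_exists (\<lambda>t. v t lam) s \<and>
        laplace (\<lambda>t. v t lam) s = 1 / (s * laplace k s + lam))"


section \<open>Classical derivatives and smooth domains\<close>

definition partials :: "'a::euclidean_space list \<Rightarrow> ('a \<Rightarrow> real) \<Rightarrow> 'a \<Rightarrow> real" where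
  "partials bs f = foldr (\<lambda>b g x. frechet_derivative g (at x) b) bs f"

definition Ck_on :: "nat \<Rightarrow> 'a::euclidean_space set \<Rightarrow> ('a \<Rightarrow> real) \<Rightarrow> bool" where
  "Ck_on m S f \<longleftrightarrow>
     (\<forall>bs. set bs \<subseteq> Basis \<and> length bs < m \<longrightarrow> (\<forall>x\<in>S. partials bs f differentiable (at x))) \<and>
     (\<forall>bs. set bs \<subseteq> Basis \<and> length bs \<le> m \<longrightarrow> continuous_on S (partials bs f))"

definition test_functions :: "'a::euclidean_space set \<Rightarrow> ('a \<Rightarrow> real) set" where
  "test_functions \<Omega> =
     {\<phi>. (\<forall>m. Ck_on m UNIV \<phi>) \<and> compact (closure {x. \<phi> x \<noteq> 0}) \<and> closure {x. \<phi> x \<noteq> 0} \<subseteq> \<Omega>}"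

text \<open>The boundary is of class \<open>C\<^sup>2\<close>: near each of its points the domain is a
  sublevel set of a \<open>C\<^sup>2\<close> function with nonvanishing derivative. This is the regularity
  behind the \<open>H\<^sup>2\<close> theory of the Dirichlet Laplacian.\<close>

definition C2_boundary :: "'a::euclidean_space set \<Rightarrow> bool" where
  "C2_boundary \<Omega> \<longleftrightarrow>
     (\<forall>p\<in>frontier \<Omega>. \<exists>U \<rho>. open U \<and> p \<in> U \<and> Ck_on 2 U \<rho> \<and>
        (\<forall>x\<in>U. \<exists>b\<in>Basis. partials [b] \<rho> x \<noteq> 0) \<and>
        \<Omega> \<inter> U = {x\<in>U. \<rho> x < 0})"

definition smooth_bounded_domain :: "'a::euclidean_space set \<Rightarrow> bool" where
  "smooth_bounded_domain \<Omega> \<longleftrightarrow>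
     open \<Omega> \<and> connected \<Omega> \<and> \<Omega> \<noteq> {} \<and> bounded \<Omega> \<and> C2_boundary \<Omega>"


section \<open>Lebesgue and Sobolev spaces\<close>

text \<open>Elements of \<open>L\<^sup>2(\<Omega>)\<close> are represented by functions on the whole space whose values
  outside \<open>\<Omega>\<close> are irrelevant; equality in \<open>L\<^sup>2(\<Omega>)\<close> is equality almost everywhere in \<open>\<Omega>\<close>.\<close>

definition L2 :: "'a::euclidean_space set \<Rightarrow> ('a \<Rightarrow> real) set" where
  "L2 \<Omega> = {f. f \<in> borel_measurable (lebesgue_on \<Omega>) \<and> integrable (lebesgue_on \<Omega>) (\<lambda>x. (f x)\<^sup>2)}"

definition L2_inner :: "'a::euclidean_space set \<Rightarrow> ('a \<Rightarrow> real) \<Rightarrow> ('a \<Rightarrow> real) \<Rightarrow> real" where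
  "L2_inner \<Omega> f g = (LINT x|lebesgue_on \<Omega>. f x * g x)"

definition L2_norm :: "'a::euclidean_space set \<Rightarrow> ('a \<Rightarrow> real) \<Rightarrow> real" where
  "L2_norm \<Omega> f = sqrt (L2_inner \<Omega> f f)"

text \<open>A multi-index is a multiset of basis vectors, its order being the size.\<close>

definition multi_indices :: "nat \<Rightarrow> 'a::euclidean_space multiset set" where
  "multi_indices m = {\<alpha>. set_mset \<alpha> \<subseteq> Basis \<and> size \<alpha> \<le> m}"

text \<open>The lists \<open>bs\<close> below are the orders in which the derivative can be carried
  out, all of which give the same result on a test function.\<close>

definition is_weak_deriv ::
  "'a::euclidean_space set \<Rightarrow> 'a multiset \<Rightarrow> ('a \<Rightarrow> real) \<Rightarrow> ('a \<Rightarrow> real) \<Rightarrow> bool" where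
  "is_weak_deriv \<Omega> \<alpha> f g \<longleftrightarrow>
     (\<forall>\<phi>\<in>test_functions \<Omega>. \<forall>bs. mset bs = \<alpha> \<longrightarrow>
        L2_inner \<Omega> f (partials bs \<phi>) = (-1) ^ size \<alpha> * L2_inner \<Omega> g \<phi>)"

text \<open>Weak derivatives are unique up to null sets, so the choice of representative is immaterial.\<close>

definition weak_deriv ::
  "'a::euclidean_space set \<Rightarrow> 'a multiset \<Rightarrow> ('a \<Rightarrow> real) \<Rightarrow> 'a \<Rightarrow> real" where
  "weak_deriv \<Omega> \<alpha> f = (if \<alpha> = {#} then f else (SOME g. g \<in> L2 \<Omega> \<and> is_weak_deriv \<Omega> \<alpha> f g))"

definition sobolev :: "nat \<Rightarrow> 'a::euclidean_space set \<Rightarrow> ('a \<Rightarrow> real) set" where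
  "sobolev m \<Omega> = {f \<in> L2 \<Omega>. \<forall>\<alpha>\<in>multi_indices m. \<exists>g\<in>L2 \<Omega>. is_weak_deriv \<Omega> \<alpha> f g}"

text \<open>Of the usual equivalent norms of \<open>H\<^sup>m(\<Omega>)\<close> we take the sum of the \<open>L\<^sup>2\<close> norms of all weak
  derivatives up to order \<open>m\<close>. It dominates the \<open>L\<^sup>2\<close> norm of the Laplacian with constant one
  when \<open>m = 2\<close>; the root of the sum of squares does not.\<close>

definition sobolev_norm :: "nat \<Rightarrow> 'a::euclidean_space set \<Rightarrow> ('a \<Rightarrow> real) \<Rightarrow> real" where
  "sobolev_norm m \<Omega> f = (\<Sum>\<alpha>\<in>multi_indices m. L2_norm \<Omega> (weak_deriv \<Omega> \<alpha> f))"

definition H10 :: "'a::euclidean_space set \<Rightarrow> ('a \<Rightarrow> real) set" where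
  "H10 \<Omega> = {f \<in> sobolev 1 \<Omega>.
     \<forall>\<epsilon>>0. \<exists>\<phi>\<in>test_functions \<Omega>. sobolev_norm 1 \<Omega> (\<lambda>x. f x - \<phi> x) < \<epsilon>}"

definition laplacian_domain :: "'a::euclidean_space set \<Rightarrow> ('a \<Rightarrow> real) set" where
  "laplacian_domain \<Omega> = H10 \<Omega> \<inter> sobolev 2 \<Omega>"

definition laplacian :: "'a::euclidean_space set \<Rightarrow> ('a \<Rightarrow> real) \<Rightarrow> 'a \<Rightarrow> real" where
  "laplacian \<Omega> f x = (\<Sum>b\<in>Basis. weak_deriv \<Omega> {#b, b#} f x)"

definition L2_orthonormal_basis :: "'a::euclidean_space set \<Rightarrow> (nat \<Rightarrow> 'a \<Rightarrow> real) \<Rightarrow> bool" where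
  "L2_orthonormal_basis \<Omega> \<phi> \<longleftrightarrow>
     (\<forall>n. \<phi> n \<in> L2 \<Omega>) \<and>
     (\<forall>m n. L2_inner \<Omega> (\<phi> m) (\<phi> n) = (if m = n then 1 else 0)) \<and>
     (\<forall>g\<in>L2 \<Omega>. (\<lambda>N. L2_norm \<Omega> (\<lambda>x. g x - (\<Sum>n<N. L2_inner \<Omega> g (\<phi> n) * \<phi> n x)))
                   \<longlonglongrightarrow> 0)"

text \<open>The eigenvalues are numbered from \<open>0\<close>.\<close>

definition dirichlet_eigensystem ::
  "'a::euclidean_space set \<Rightarrow> (nat \<Rightarrow> real) \<Rightarrow> (nat \<Rightarrow> 'a \<Rightarrow> real) \<Rightarrow> bool" where
  "dirichlet_eigensystem \<Omega> lam \<phi> \<longleftrightarrow>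
     0 < lam 0 \<and> incseq lam \<and> filterlim lam at_top sequentially \<and>
     L2_orthonormal_basis \<Omega> \<phi> \<and>
     (\<forall>n. \<phi> n \<in> laplacian_domain \<Omega> \<and>
        (AE x in lebesgue_on \<Omega>. laplacian \<Omega> (\<phi> n) x = - lam n * \<phi> n x))"


section \<open>The inverse source problem\<close>

text \<open>Solutions are continuous with values in \<open>L\<^sup>2(\<Omega>)\<close>. The boundary condition is membership in
  \<open>H\<^sub>0\<^sup>1(\<Omega>)\<close>, which is part of the domain of the Laplacian. The differential equation holds at
  every time in \<open>L\<^sup>2(\<Omega>)\<close>, the operator in time being taken weakly, that is, after pairing with
  an arbitrary element of \<open>L\<^sup>2(\<Omega>)\<close>.\<close>

definition solves_ibvp ::
  "(real \<Rightarrow> real) \<Rightarrow> 'a::euclidean_space set \<Rightarrow> real \<Rightarrow> ('a \<Rightarrow> real) \<Rightarrow> (real \<Rightarrow> real) \<Rightarrow>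
     ('a \<Rightarrow> real \<Rightarrow> real) \<Rightarrow> bool" where
  "solves_ibvp k \<Omega> T f q u \<longleftrightarrow>
     (\<forall>t\<in>{0..T}. (\<lambda>x. u x t) \<in> L2 \<Omega>) \<and>
     (\<forall>t\<in>{0..T}. ((\<lambda>r. L2_norm \<Omega> (\<lambda>x. u x r - u x t)) \<longlongrightarrow> 0) (at t within {0..T})) \<and>
     (\<forall>t\<in>{0<..<T}. (\<lambda>x. u x t) \<in> laplacian_domain \<Omega>) \<and>
     (\<forall>t\<in>{0<..<T}. \<forall>g\<in>L2 \<Omega>.
        convol k (\<lambda>\<tau>. L2_inner \<Omega> (\<lambda>x. u x \<tau>) g) differentiable (at t) \<and>
        gen_deriv k (\<lambda>\<tau>. L2_inner \<Omega> (\<lambda>x. u x \<tau>) g) t =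
          L2_inner \<Omega> (\<lambda>x. laplacian \<Omega> (\<lambda>y. u y t) x + f x * q t) g) \<and>
     (AE x in lebesgue_on \<Omega>. u x 0 = 0)"

definition solves_inverse_problem ::
  "(real \<Rightarrow> real) \<Rightarrow> 'a::euclidean_space set \<Rightarrow> real \<Rightarrow> (real \<Rightarrow> real) \<Rightarrow> ('a \<Rightarrow> real) \<Rightarrow>
     ('a \<Rightarrow> real) \<Rightarrow> ('a \<Rightarrow> real \<Rightarrow> real) \<Rightarrow> bool" where
  "solves_inverse_problem k \<Omega> T q h f u \<longleftrightarrow>
     solves_ibvp k \<Omega> T f q u \<and> (AE x in lebesgue_on \<Omega>. u x T = h x)"

end

theory Submission
  imports Defs "HOL-Real_Asymp.Real_Asymp"
begin

text \<open>
The idea is to expand in eigenfunctions. Pairing the equation with the \<open>n\<close>-th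
eigenfunction gives the scalar equation \<open>\<D> w + \<lambda> w = f\<^sub>n q\<close> with \<open>w (0) = 0\<close>, whose solution is \<open>f\<^sub>n\<close> times
the convolution of \<open>q\<close> with the impulse response; hence \<open>h\<^sub>n = f\<^sub>n Q\<^sub>n\<close>. If \<open>Q\<^sub>n \<ge> C / \<lambda>\<^sub>n\<close>, then
\<open>C f\<^sub>n\<^sup>2 \<le> \<bar>\<lambda>\<^sub>n f\<^sub>n\<bar> \<bar>h\<^sub>n\<bar>\<close>, and \<open>- \<lambda>\<^sub>n f\<^sub>n\<close> is the \<open>n\<close>-th coefficient of the Laplacian of \<open>f\<close>. Summation yields
\<open>C \<parallel>f\<parallel>\<^sup>2 \<le> \<parallel>\<Delta>f\<parallel> \<parallel>h\<parallel> \<le> E \<parallel>h\<parallel>\<close>. Four facts carry this.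

Positivity of the impulse response \<open>v\<close> (\<open>impulse_moments_nonneg\<close>). In general \<open>v\<close> is known through its Laplace
transform \<open>1 / (s * laplace k s + \<lambda>)\<close> alone. As \<open>laplace k\<close> is a Stieltjes function, \<open>s * laplace k s\<close> is a Bernstein
function, so the transform of \<open>v\<close> is completely monotone. All of this is done with
finite differences at the integers: the differences are moments of the signed measure
\<open>exp (- t) v (t) dt\<close> in the variable \<open>exp (- t)\<close>, and Bernstein polynomials recover from them the integrals of \<open>v\<close> against
continuous functions (\<open>moment_comparison\<close>, \<open>moment_comparison_halfline\<close>).

The lower bound (\<open>impulse_convol_uniform_lower_bound\<close>). Positivity bounds the mass of \<open>v\<close> after time \<open>T\<close> by an
exponentially small multiple of a Laplace transform, whereas the transform itself decays only like
\<open>1 / s\<close>, because \<open>laplace k\<close> tends to zero at infinity. Comparing the two at one large \<open>s\<close> gives the constant.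

The scalar equation (\<open>relaxation_equation_solution\<close>). The transforms of \<open>v\<close> and \<open>k + \<lambda>\<close> multiply to \<open>1 / s\<close>, so
\<open>v\<close> is the resolvent of the integrated equation. The uniqueness theorem behind this is again the
moment argument, now on a product space (\<open>moment_equality_halfline\<close>).

Symmetry of the Laplacian (\<open>laplacian_green\<close>, \<open>laplacian_symmetric\<close>). Elements of \<open>H10 \<Omega>\<close> are limits of test functions
in a norm built from arbitrarily chosen weak derivatives, so uniqueness of weak derivatives is
needed. It follows from the eigensystem itself: eigenfunctions are limits of test functions and
form a basis, hence test functions are dense (\<open>dirichlet_eigensystem_separates\<close>).\<close>

section \<open>Signed densities and their moments\<close>

lemma integrable_moment:
  fixes Y \<rho> :: "'b \<Rightarrow> real"
  assumes Y[measurable]: "Y \<in> borel_measurable M" and \<rho>: "integrable M \<rho>"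
    and Y01: "\<And>x. x \<in> space M \<Longrightarrow> \<rho> x \<noteq> 0 \<Longrightarrow> Y x \<in> {0..1}"
  shows "integrable M (\<lambda>x. Y x ^ k * (1 - Y x) ^ l * \<rho> x)"
proof (rule Bochner_Integration.integrable_bound[OF \<rho>])
  note [measurable] = borel_measurable_integrable[OF \<rho>]
  show "(\<lambda>x. Y x ^ k * (1 - Y x) ^ l * \<rho> x) \<in> borel_measurable M" by measurable
  show "AE x in M. norm (Y x ^ k * (1 - Y x) ^ l * \<rho> x) \<le> norm (\<rho> x)"
  proof (rule AE_I2)
    fix x assume x: "x \<in> space M"
    show "norm (Y x ^ k * (1 - Y x) ^ l * \<rho> x) \<le> norm (\<rho> x)"
    proof (cases "\<rho> x = 0")
      case False
      then have "Y x \<in> {0..1}" using Y01 x by auto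
      then have "\<bar>Y x ^ k * (1 - Y x) ^ l\<bar> \<le> 1"
        by (simp add: abs_mult power_abs power_le_one mult_le_one)
      then show ?thesis by (simp add: abs_mult mult_left_le_one_le)
    qed auto
  qed
qed

text \<open>Bernstein polynomials in \<open>Y\<close> are combinations of the mixed moments of \<open>Y\<close> and \<open>1 - Y\<close>, so these
moments determine the integral of every continuous function of \<open>Y\<close>. The weight \<open>\<rho>\<close> is a density of a
finite signed measure; no sign is assumed, because positivity is what the moments are to reveal.\<close>

lemma bernstein_moments_tendsto:
  fixes Y \<rho> :: "'b \<Rightarrow> real" and F :: "real \<Rightarrow> real"
  assumes Y[measurable]: "Y \<in> borel_measurable M" and \<rho>: "integrable M \<rho>"
    and Y01: "\<And>x. x \<in> space M \<Longrightarrow> \<rho> x \<noteq> 0 \<Longrightarrow> Y x \<in> {0..1}"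
    and F: "continuous_on UNIV F"
  shows "(\<lambda>N. \<Sum>k\<le>N. F (real k / real N) * real (N choose k) *
              (\<integral>x. Y x ^ k * (1 - Y x) ^ (N - k) * \<rho> x \<partial>M))
          \<longlonglongrightarrow> (\<integral>x. F (Y x) * \<rho> x \<partial>M)"
proof -
  note [measurable] = borel_measurable_continuous_onI[OF F]
  have m\<rho>[measurable]: "\<rho> \<in> borel_measurable M" by (rule borel_measurable_integrable[OF \<rho>])
  define B where "B N y = (\<Sum>k\<le>N. F (real k / real N) * Bernstein N k y)" for N y
  have [measurable]: "B N \<in> borel_measurable borel" for N
    unfolding B_def Bernstein_def by measurable
  have unif: "\<exists>N0. \<forall>N\<ge>N0. \<forall>y\<in>{0..1}. \<bar>F y - B N y\<bar> < e" if "e > 0" for e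
    using Bernstein_Weierstrass[OF continuous_on_subset[OF F subset_UNIV] that]
    unfolding B_def by blast
  note intk = integrable_moment[OF assms(1-3)]
  have sumeq: "(\<integral>x. B N (Y x) * \<rho> x \<partial>M) = (\<Sum>k\<le>N. F (real k / real N) * real (N choose k) *
              (\<integral>x. Y x ^ k * (1 - Y x) ^ (N - k) * \<rho> x \<partial>M))" for N
  proof -
    have "(\<integral>x. B N (Y x) * \<rho> x \<partial>M) = (\<integral>x. (\<Sum>k\<le>N. (F (real k / real N) * real (N choose k)) *
              (Y x ^ k * (1 - Y x) ^ (N - k) * \<rho> x)) \<partial>M)"
      unfolding B_def Bernstein_def
      by (intro Bochner_Integration.integral_cong refl) (simp add: sum_distrib_left sum_distrib_right mult_ac)
    also have "\<dots> = (\<Sum>k\<le>N. F (real k / real N) * real (N choose k) *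
              (\<integral>x. Y x ^ k * (1 - Y x) ^ (N - k) * \<rho> x \<partial>M))"
      by (subst Bochner_Integration.integral_sum) (auto intro: intk)
    finally show ?thesis .
  qed
  obtain C where C: "\<And>y. y \<in> {0..1} \<Longrightarrow> \<bar>F y\<bar> \<le> C"
    using compact_continuous_image[OF continuous_on_subset[OF F], of "{0..1}"]
    by (force simp: bounded_iff dest!: compact_imp_bounded)
  obtain N1 where N1: "\<And>N y. N \<ge> N1 \<Longrightarrow> y \<in> {0..1} \<Longrightarrow> \<bar>F y - B N y\<bar> < 1"
    using unif[OF zero_less_one] by blast
  have "(\<lambda>N. \<integral>x. B (N + N1) (Y x) * \<rho> x \<partial>M) \<longlonglongrightarrow> (\<integral>x. F (Y x) * \<rho> x \<partial>M)"
  proof (rule integral_dominated_convergence[where w = "\<lambda>x. (C + 1) * \<bar>\<rho> x\<bar>"])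
    show "integrable M (\<lambda>x. (C + 1) * \<bar>\<rho> x\<bar>)" using \<rho> by auto
    show "AE x in M. (\<lambda>i. B (i + N1) (Y x) * \<rho> x) \<longlonglongrightarrow> F (Y x) * \<rho> x"
    proof (rule AE_I2)
      fix x assume x: "x \<in> space M"
      show "(\<lambda>i. B (i + N1) (Y x) * \<rho> x) \<longlonglongrightarrow> F (Y x) * \<rho> x"
      proof (cases "\<rho> x = 0")
        case False
        then have "Y x \<in> {0..1}" using Y01 x by auto
        then have "(\<lambda>i. B i (Y x)) \<longlonglongrightarrow> F (Y x)"
          using unif by (fastforce simp: LIMSEQ_iff abs_minus_commute)
        then show ?thesis by (intro tendsto_mult_right LIMSEQ_ignore_initial_segment)
      qed auto
    qed
    show "AE x in M. norm (B (i + N1) (Y x) * \<rho> x) \<le> (C + 1) * \<bar>\<rho> x\<bar>" for i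
    proof (rule AE_I2)
      fix x assume x: "x \<in> space M"
      show "norm (B (i + N1) (Y x) * \<rho> x) \<le> (C + 1) * \<bar>\<rho> x\<bar>"
      proof (cases "\<rho> x = 0")
        case False
        then have y: "Y x \<in> {0..1}" using Y01 x by auto
        have "\<bar>B (i + N1) (Y x)\<bar> \<le> C + 1" using C[OF y] N1[OF _ y, of "i + N1"] by auto
        then show ?thesis by (simp add: abs_mult mult_right_mono)
      qed auto
    qed
  qed measurable
  then show ?thesis unfolding sumeq by (rule LIMSEQ_offset)
qed

text \<open>The coefficients of the Bernstein polynomials of a nonnegative function are nonnegative, so an
inequality between moments passes to the limit. The two measure spaces may differ.\<close>

lemma moment_comparison:
  fixes Y \<rho> :: "'b \<Rightarrow> real" and Y' \<rho>' :: "'c \<Rightarrow> real" and F :: "real \<Rightarrow> real"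
  assumes "Y \<in> borel_measurable M" "integrable M \<rho>"
    "\<And>x. x \<in> space M \<Longrightarrow> \<rho> x \<noteq> 0 \<Longrightarrow> Y x \<in> {0..1}"
    "Y' \<in> borel_measurable M'" "integrable M' \<rho>'"
    "\<And>x. x \<in> space M' \<Longrightarrow> \<rho>' x \<noteq> 0 \<Longrightarrow> Y' x \<in> {0..1}"
    and mom: "\<And>n m. (\<integral>x. Y' x ^ n * (1 - Y' x) ^ m * \<rho>' x \<partial>M')
                   \<le> (\<integral>x. Y x ^ n * (1 - Y x) ^ m * \<rho> x \<partial>M)"
    and F: "continuous_on UNIV F" "\<And>y. y \<in> {0..1} \<Longrightarrow> 0 \<le> F y"
  shows "(\<integral>x. F (Y' x) * \<rho>' x \<partial>M') \<le> (\<integral>x. F (Y x) * \<rho> x \<partial>M)"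
proof (rule LIMSEQ_le[OF bernstein_moments_tendsto[where Y = Y' and \<rho> = \<rho>' and M = M' and F = F]
        bernstein_moments_tendsto[where Y = Y and \<rho> = \<rho> and M = M and F = F]])
  have "F (real k / real N) \<ge> 0" if "k \<le> N" for k N
    using that by (intro F(2)) (cases "N = 0", auto simp: field_simps)
  then show "\<exists>K. \<forall>N\<ge>K.
     (\<Sum>k\<le>N. F (real k / real N) * real (N choose k) * (\<integral>x. Y' x ^ k * (1 - Y' x) ^ (N - k) * \<rho>' x \<partial>M'))
   \<le> (\<Sum>k\<le>N. F (real k / real N) * real (N choose k) * (\<integral>x. Y x ^ k * (1 - Y x) ^ (N - k) * \<rho> x \<partial>M))"
    by (intro exI allI impI sum_mono mult_left_mono mom) auto
qed (use assms in auto)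

text \<open>In the variable \<open>y = exp (- z)\<close>, the function \<open>p (z) \<cdot> 1\<^bsub>z<T\<^esub>\<close> becomes \<open>p (- ln y)\<close> cut off at
\<open>y = exp (- T)\<close>. The last factor replaces the jump there by a ramp of slope \<open>j\<close>; the division by \<open>y\<close>
cancels the weight \<open>exp (- z)\<close> that makes a Laplace transformable density integrable; and \<open>y\<close> is
clipped to \<open>[exp (- T), 1]\<close> so that the result is continuous on the whole line.\<close>

definition cutoff :: "real \<Rightarrow> (real \<Rightarrow> real) \<Rightarrow> nat \<Rightarrow> real \<Rightarrow> real" where
  "cutoff T p j y = p (- ln (max (exp (- T)) (min 1 y))) / max (exp (- T)) (min 1 y) *
     min 1 (max 0 (real j * (y - exp (- T))))"

lemma cutoff_base_pos: "max (exp (- T)) (min 1 y) > (0::real)"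
  by (simp add: less_max_iff_disj)

lemma cutoff_arg: "T > 0 \<Longrightarrow> - ln (max (exp (- T)) (min 1 y)) \<in> {0..T::real}"
proof -
  assume T: "T > 0"
  define z where "z = max (exp (- T)) (min 1 y)"
  have "exp (- T) \<le> z" "z \<le> 1" using T by (simp_all add: z_def)
  moreover have "0 < z" using \<open>exp (- T) \<le> z\<close> exp_gt_zero[of "-T"] by linarith
  ultimately have "- T \<le> ln z" "ln z \<le> 0" by (auto simp: ln_ge_iff)
  then show ?thesis unfolding z_def by auto
qed

lemma continuous_cutoff:
  assumes "T > 0" "continuous_on {0..T} p"
  shows "continuous_on UNIV (cutoff T p j)"
proof -
  note pos = cutoff_base_pos
  have "continuous_on UNIV (\<lambda>y. p (- ln (max (exp (- T)) (min 1 y))))"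
    by (rule continuous_on_compose2[OF assms(2)])
       (use cutoff_arg[OF assms(1)] pos in \<open>auto intro!: continuous_intros simp: less_imp_neq[symmetric]\<close>)
  then show ?thesis unfolding cutoff_def
    using pos by (intro continuous_intros) (auto simp: less_imp_neq[symmetric])
qed

lemma cutoff_exp:
  assumes "T > 0" "z \<ge> 0"
  shows "(\<lambda>j. cutoff T p j (exp (- z)) * exp (- z)) \<longlonglongrightarrow> indicator {..<T} z * p z"
proof (cases "z < T")
  case True
  then have y: "max (exp (- T)) (min 1 (exp (- z))) = exp (- z)" using assms by auto
  define d where "d = exp (- z) - exp (- T)"
  have "d > 0" using True by (simp add: d_def)
  then have "(\<lambda>j. min 1 (max 0 (real j * d))) \<longlonglongrightarrow> 1" by real_asymp
  then have "(\<lambda>j. p z * min 1 (max 0 (real j * d))) \<longlonglongrightarrow> p z * 1" by (intro tendsto_mult_left)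
  moreover have "cutoff T p j (exp (- z)) * exp (- z) = p z * min 1 (max 0 (real j * d))" for j
    unfolding cutoff_def y d_def by simp
  ultimately show ?thesis using True by simp
next
  case False
  then have "real j * (exp (- z) - exp (- T)) \<le> 0" for j
    by (intro mult_nonneg_nonpos) auto
  then have "cutoff T p j (exp (- z)) = 0" for j
    unfolding cutoff_def by (simp add: max_absorb1)
  then show ?thesis using False by simp
qed

lemma cutoff_tendsto:
  fixes Z \<rho> :: "'b \<Rightarrow> real" and p :: "real \<Rightarrow> real"
  assumes Z[measurable]: "Z \<in> borel_measurable M" and \<rho>: "integrable M (\<lambda>x. exp (- Z x) * \<rho> x)"
    and Z0: "\<And>x. x \<in> space M \<Longrightarrow> \<rho> x \<noteq> 0 \<Longrightarrow> 0 \<le> Z x"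
    and T: "T > 0" and p: "continuous_on {0..T} p"
  shows "(\<lambda>j. \<integral>x. cutoff T p j (exp (- Z x)) * (exp (- Z x) * \<rho> x) \<partial>M)
     \<longlonglongrightarrow> (\<integral>x. indicator {..<T} (Z x) * p (Z x) * \<rho> x \<partial>M)"
    and "integrable M (\<lambda>x. indicator {..<T} (Z x) * p (Z x) * \<rho> x)"
proof -
  note [measurable] = borel_measurable_continuous_onI[OF continuous_cutoff[OF T p]]
  obtain C where C: "\<And>y. y \<in> {0..T} \<Longrightarrow> \<bar>p y\<bar> \<le> C"
    using compact_continuous_image[OF p]
    by (force simp: bounded_iff dest!: compact_imp_bounded)
  have C0: "C \<ge> 0" using C[of 0] T by auto
  have cb: "\<bar>cutoff T p j y\<bar> \<le> C * exp T" for j y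
  proof -
    define z where "z = max (exp (- T)) (min 1 y)"
    have z: "z \<ge> exp (- T)" "z > 0" using cutoff_base_pos by (auto simp: z_def)
    have "\<bar>p (- ln z)\<bar> \<le> C" using cutoff_arg[OF T] C unfolding z_def by blast
    then have "\<bar>p (- ln z) / z\<bar> \<le> C / exp (- T)"
      using z C0 by (auto simp: abs_divide intro!: frac_le)
    moreover have "\<bar>min 1 (max 0 (real j * (y - exp (- T))))\<bar> \<le> 1" by auto
    ultimately have "\<bar>cutoff T p j y\<bar> \<le> C / exp (- T) * 1"
      unfolding cutoff_def z_def[symmetric] abs_mult using C0 by (intro mult_mono) auto
    then show ?thesis by (simp add: exp_minus divide_inverse)
  qed
  have ind: "(\<lambda>j. cutoff T p j (exp (- Z x)) * (exp (- Z x) * \<rho> x))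
              \<longlonglongrightarrow> indicator {..<T} (Z x) * p (Z x) * \<rho> x" if "x \<in> space M" for x
  proof (cases "\<rho> x = 0")
    case False
    have "(\<lambda>j. cutoff T p j (exp (- Z x)) * exp (- Z x) * \<rho> x)
              \<longlonglongrightarrow> indicator {..<T} (Z x) * p (Z x) * \<rho> x"
      by (intro tendsto_mult_right cutoff_exp[OF T Z0[OF that False]])
    then show ?thesis by (simp add: mult.assoc)
  qed auto
  have [measurable]: "(\<lambda>x. exp (- Z x) * \<rho> x) \<in> borel_measurable M" using \<rho> by auto
  have ms: "(\<lambda>x. cutoff T p j (exp (- Z x)) * (exp (- Z x) * \<rho> x)) \<in> borel_measurable M" for j
    by measurable
  have lm: "(\<lambda>x. indicator {..<T} (Z x) * p (Z x) * \<rho> x) \<in> borel_measurable M"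
    using borel_measurable_LIMSEQ_real[OF ind ms] .
  have dom: "integrable M (\<lambda>x. (C * exp T) * \<bar>exp (- Z x) * \<rho> x\<bar>)"
    using \<rho> by auto
  have bd: "AE x in M. norm (cutoff T p j (exp (- Z x)) * (exp (- Z x) * \<rho> x)) \<le> C * exp T * \<bar>exp (- Z x) * \<rho> x\<bar>" for j
    unfolding real_norm_def abs_mult[of "cutoff _ _ _ _"] by (intro AE_I2 mult_right_mono cb) auto
  show "(\<lambda>j. \<integral>x. cutoff T p j (exp (- Z x)) * (exp (- Z x) * \<rho> x) \<partial>M)
     \<longlonglongrightarrow> (\<integral>x. indicator {..<T} (Z x) * p (Z x) * \<rho> x \<partial>M)"
    by (rule integral_dominated_convergence[where s = "\<lambda>j x. cutoff T p j (exp (- Z x)) * (exp (- Z x) * \<rho> x)",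
        OF lm ms dom AE_I2[OF ind] bd])
  show "integrable M (\<lambda>x. indicator {..<T} (Z x) * p (Z x) * \<rho> x)"
    by (rule integrable_dominated_convergence[where s = "\<lambda>j x. cutoff T p j (exp (- Z x)) * (exp (- Z x) * \<rho> x)",
        OF lm ms dom AE_I2[OF ind] bd])
qed

text \<open>Here the moments are values of Laplace transforms and their iterated differences at the positive
integers, and the conclusion concerns the densities themselves on a bounded time interval. It
replaces an inversion formula.\<close>

lemma moment_comparison_halfline:
  fixes Z \<rho> :: "'b \<Rightarrow> real" and Z' \<rho>' :: "'c \<Rightarrow> real" and p :: "real \<Rightarrow> real"
  assumes M: "Z \<in> borel_measurable M" "integrable M (\<lambda>x. exp (- Z x) * \<rho> x)"
    "\<And>x. x \<in> space M \<Longrightarrow> \<rho> x \<noteq> 0 \<Longrightarrow> 0 \<le> Z x"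
    and M': "Z' \<in> borel_measurable M'" "integrable M' (\<lambda>x. exp (- Z' x) * \<rho>' x)"
    "\<And>x. x \<in> space M' \<Longrightarrow> \<rho>' x \<noteq> 0 \<Longrightarrow> 0 \<le> Z' x"
    and mom: "\<And>n m. (\<integral>x. exp (- Z' x) ^ n * (1 - exp (- Z' x)) ^ m * (exp (- Z' x) * \<rho>' x) \<partial>M')
                   \<le> (\<integral>x. exp (- Z x) ^ n * (1 - exp (- Z x)) ^ m * (exp (- Z x) * \<rho> x) \<partial>M)"
    and T: "T > 0" and p: "continuous_on {0..T} p" "\<And>t. t \<in> {0..T} \<Longrightarrow> 0 \<le> p t"
  shows "(\<integral>x. indicator {..<T} (Z' x) * p (Z' x) * \<rho>' x \<partial>M')
           \<le> (\<integral>x. indicator {..<T} (Z x) * p (Z x) * \<rho> x \<partial>M)"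
proof (rule LIMSEQ_le[OF cutoff_tendsto(1)[OF M' T p(1)] cutoff_tendsto(1)[OF M T p(1)]], simp_all)
  have nn: "0 \<le> cutoff T p j y" for j y
    unfolding cutoff_def using p(2)[OF cutoff_arg[OF T]] cutoff_base_pos
    by (intro mult_nonneg_nonneg divide_nonneg_pos) auto
  have me: "(\<lambda>x. exp (- Z x)) \<in> borel_measurable M" "(\<lambda>x. exp (- Z' x)) \<in> borel_measurable M'"
    using M(1) M'(1) by measurable
  show "\<exists>N. \<forall>n\<ge>N. (\<integral>x. cutoff T p n (exp (- Z' x)) * (exp (- Z' x) * \<rho>' x) \<partial>M')
              \<le> (\<integral>x. cutoff T p n (exp (- Z x)) * (exp (- Z x) * \<rho> x) \<partial>M)"
    by (intro exI allI impI moment_comparison[OF me(1) M(2) _ me(2) M'(2) _ mom continuous_cutoff[OF T p(1)] nn])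
       (use M(3) M'(3) in auto)
qed

text \<open>A uniqueness theorem for Laplace transforms in a form that lets one side live on a product space, so
that convolutions of merely integrable functions need not be formed.\<close>

lemma moment_equality_halfline:
  fixes Z \<rho> :: "'b \<Rightarrow> real" and Z' \<rho>' :: "'c \<Rightarrow> real" and p :: "real \<Rightarrow> real"
  assumes M: "Z \<in> borel_measurable M" "integrable M (\<lambda>x. exp (- Z x) * \<rho> x)"
    "\<And>x. x \<in> space M \<Longrightarrow> \<rho> x \<noteq> 0 \<Longrightarrow> 0 \<le> Z x"
    and M': "Z' \<in> borel_measurable M'" "integrable M' (\<lambda>x. exp (- Z' x) * \<rho>' x)"
    "\<And>x. x \<in> space M' \<Longrightarrow> \<rho>' x \<noteq> 0 \<Longrightarrow> 0 \<le> Z' x"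
    and mom: "\<And>n m. (\<integral>x. exp (- Z x) ^ n * (1 - exp (- Z x)) ^ m * (exp (- Z x) * \<rho> x) \<partial>M)
                   = (\<integral>x. exp (- Z' x) ^ n * (1 - exp (- Z' x)) ^ m * (exp (- Z' x) * \<rho>' x) \<partial>M')"
    and T: "T > 0" and p: "continuous_on {0..T} p"
  shows "(\<integral>x. indicator {..<T} (Z x) * p (Z x) * \<rho> x \<partial>M)
           = (\<integral>x. indicator {..<T} (Z' x) * p (Z' x) * \<rho>' x \<partial>M')"
proof -
  have me: "(\<lambda>x. exp (- Z x)) \<in> borel_measurable M" "(\<lambda>x. exp (- Z' x)) \<in> borel_measurable M'"
    using M(1) M'(1) by measurable
  have eq: "(\<integral>x. cutoff T p j (exp (- Z x)) * (exp (- Z x) * \<rho> x) \<partial>M)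
      = (\<integral>x. cutoff T p j (exp (- Z' x)) * (exp (- Z' x) * \<rho>' x) \<partial>M')" for j
  proof (rule LIMSEQ_unique)
    let ?B = "\<lambda>N. \<Sum>k\<le>N. cutoff T p j (real k / real N) * real (N choose k) *
        (\<integral>x. exp (- Z x) ^ k * (1 - exp (- Z x)) ^ (N - k) * (exp (- Z x) * \<rho> x) \<partial>M)"
    show "?B \<longlonglongrightarrow> (\<integral>x. cutoff T p j (exp (- Z x)) * (exp (- Z x) * \<rho> x) \<partial>M)"
      by (rule bernstein_moments_tendsto[OF me(1) M(2) _ continuous_cutoff[OF T p]]) (use M(3) in auto)
    show "?B \<longlonglongrightarrow> (\<integral>x. cutoff T p j (exp (- Z' x)) * (exp (- Z' x) * \<rho>' x) \<partial>M')"
      unfolding mom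
      by (rule bernstein_moments_tendsto[OF me(2) M'(2) _ continuous_cutoff[OF T p]]) (use M'(3) in auto)
  qed
  show ?thesis
    using LIMSEQ_unique[OF cutoff_tendsto(1)[OF M T p, unfolded eq] cutoff_tendsto(1)[OF M' T p]] .
qed

section \<open>Completely monotone sequences\<close>

definition neg_diff :: "(nat \<Rightarrow> real) \<Rightarrow> nat \<Rightarrow> real" where
  "neg_diff f n = f n - f (Suc n)"

text \<open>Finite differences stand in for derivatives: only the values of Laplace transforms at integers
enter. The order is bounded because the reciprocal of a sequence is treated by induction on it.\<close>

primrec cm_upto :: "nat \<Rightarrow> (nat \<Rightarrow> real) \<Rightarrow> bool" where
  "cm_upto 0 f \<longleftrightarrow> (\<forall>n. 0 \<le> f n)"
| "cm_upto (Suc m) f \<longleftrightarrow> (\<forall>n. 0 \<le> f n) \<and> cm_upto m (neg_diff f)"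

lemma cm_upto_Suc_imp: "cm_upto (Suc m) f \<Longrightarrow> cm_upto m f"
  by (induction m arbitrary: f) auto

lemma cm_upto_shift: "cm_upto m f \<Longrightarrow> cm_upto m (\<lambda>n. f (Suc n))"
proof (induction m arbitrary: f)
  case (Suc m)
  then have "cm_upto m (\<lambda>n. neg_diff f (Suc n))" by simp
  then show ?case using Suc.prems by (simp add: neg_diff_def[abs_def])
qed auto

lemma cm_upto_add: "cm_upto m f \<Longrightarrow> cm_upto m g \<Longrightarrow> cm_upto m (\<lambda>n. f n + g n)"
proof (induction m arbitrary: f g)
  case (Suc m)
  have "neg_diff (\<lambda>n. f n + g n) = (\<lambda>n. neg_diff f n + neg_diff g n)"
    by (auto simp: neg_diff_def)
  then show ?case using Suc by simp
qed auto

lemma cm_upto_mult: "cm_upto m f \<Longrightarrow> cm_upto m g \<Longrightarrow> cm_upto m (\<lambda>n. f n * g n)"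
proof (induction m arbitrary: f g)
  case (Suc m)
  have "neg_diff (\<lambda>n. f n * g n) = (\<lambda>n. neg_diff f n * g n + f (Suc n) * neg_diff g n)"
    by (auto simp: neg_diff_def algebra_simps)
  moreover have "cm_upto m (\<lambda>n. neg_diff f n * g n + f (Suc n) * neg_diff g n)"
    using Suc.prems cm_upto_Suc_imp[OF Suc.prems(1)] cm_upto_Suc_imp[OF Suc.prems(2)]
    by (intro cm_upto_add Suc.IH cm_upto_shift) auto
  ultimately show ?case using Suc.prems by simp
qed auto

lemma cm_upto_const: "c \<ge> 0 \<Longrightarrow> cm_upto m (\<lambda>n. c)"
proof (induction m arbitrary: c)
  case (Suc m)
  have "neg_diff (\<lambda>n. c) = (\<lambda>n. 0)" by (auto simp: neg_diff_def)
  then show ?case using Suc by simp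
qed auto

lemma cm_upto_iterate_nonneg: "cm_upto m f \<Longrightarrow> 0 \<le> (neg_diff ^^ m) f n"
  by (induction m arbitrary: f) (auto simp: funpow_Suc_right simp del: funpow.simps(2))

lemma cm_uptoI: "(\<And>j n. 0 \<le> (neg_diff ^^ j) f n) \<Longrightarrow> cm_upto m f"
proof (induction m arbitrary: f)
  case 0
  from 0[of 0] show ?case by simp
next
  case (Suc m)
  have "cm_upto m (neg_diff f)"
  proof (rule Suc.IH)
    show "0 \<le> (neg_diff ^^ j) (neg_diff f) n" for j n
      using Suc.prems[where j = "Suc j" and n = n] by (simp add: funpow_swap1)
  qed
  then show ?case using Suc.prems[of 0] by simp
qed

text \<open>The discrete form of the fact that \<open>1 / (g + c)\<close> is completely monotone for a Bernstein function \<open>g\<close>: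
the difference of \<open>1 / (g + c)\<close> is the product of the difference of \<open>g\<close>, of \<open>1 / (g + c)\<close> and of its
shift, all of which are monotone up to the order already reached.\<close>

lemma cm_upto_inverse:
  assumes "c > 0" and g: "\<And>n. 0 \<le> g n" "\<And>m. cm_upto m (\<lambda>n. g (Suc n) - g n)"
  shows "cm_upto m (\<lambda>n. 1 / (g n + c))"
proof (induction m)
  case 0
  show ?case using assms(1) g(1) by (simp add: add_nonneg_nonneg)
next
  case (Suc m)
  have pos: "g n + c > 0" for n using assms(1) g(1)[of n] by linarith
  have "neg_diff (\<lambda>n. 1 / (g n + c)) = (\<lambda>n. (g (Suc n) - g n) * (1 / (g n + c) * (1 / (g (Suc n) + c))))"
    using pos by (auto simp: neg_diff_def fun_eq_iff field_simps less_imp_neq[symmetric])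
  moreover have "cm_upto m (\<lambda>n. (g (Suc n) - g n) * (1 / (g n + c) * (1 / (g (Suc n) + c))))"
    by (intro cm_upto_mult g(2) Suc.IH cm_upto_shift[OF Suc.IH])
  ultimately show ?case using pos by (simp add: less_imp_le)
qed

section \<open>Positivity of the impulse response\<close>

text \<open>A difference in the exponent contributes a factor \<open>1 - Y\<close>.\<close>

lemma neg_diff_moments:
  fixes Y \<rho> :: "'b \<Rightarrow> real"
  assumes "Y \<in> borel_measurable M" "integrable M \<rho>"
    "\<And>x. x \<in> space M \<Longrightarrow> \<rho> x \<noteq> 0 \<Longrightarrow> Y x \<in> {0..1}"
  shows "(neg_diff ^^ m) (\<lambda>n. \<integral>x. Y x ^ n * \<rho> x \<partial>M) n = (\<integral>x. Y x ^ n * (1 - Y x) ^ m * \<rho> x \<partial>M)"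
proof (induction m arbitrary: n)
  case (Suc m)
  note I = integrable_moment[OF assms]
  have "(neg_diff ^^ Suc m) (\<lambda>n. \<integral>x. Y x ^ n * \<rho> x \<partial>M) n
      = (\<integral>x. Y x ^ n * (1 - Y x) ^ m * \<rho> x \<partial>M) - (\<integral>x. Y x ^ Suc n * (1 - Y x) ^ m * \<rho> x \<partial>M)"
    using Suc[of n] Suc[of "Suc n"] by (simp add: neg_diff_def[of "(neg_diff ^^ m) _"])
  also have "\<dots> = (\<integral>x. Y x ^ n * (1 - Y x) ^ m * \<rho> x - Y x ^ Suc n * (1 - Y x) ^ m * \<rho> x \<partial>M)"
    by (rule Bochner_Integration.integral_diff[symmetric, OF I I])
  also have "\<dots> = (\<integral>x. Y x ^ n * (1 - Y x) ^ Suc m * \<rho> x \<partial>M)"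
    by (intro Bochner_Integration.integral_cong refl) (simp add: algebra_simps)
  finally show ?case .
qed simp

text \<open>With \<open>Y = exp (- x)\<close> the factor in front of \<open>\<rho>\<close> is \<open>- 1 / Y\<close> times the derivative in \<open>x\<close> of
\<open>Y ^ (n + 1) * (1 - Y) ^ (m + 1)\<close>; in particular it changes its sign exactly once.\<close>

lemma neg_diff_moments_weighted:
  fixes Y \<rho> :: "'b \<Rightarrow> real"
  assumes "Y \<in> borel_measurable M" "integrable M \<rho>"
    "\<And>x. x \<in> space M \<Longrightarrow> \<rho> x \<noteq> 0 \<Longrightarrow> Y x \<in> {0..1}"
  shows "(neg_diff ^^ Suc m) (\<lambda>n. real (Suc n) * (\<integral>x. Y x ^ n * \<rho> x \<partial>M)) n =
      (\<integral>x. Y x ^ n * (1 - Y x) ^ m * (real (n + 1) - real (n + m + 2) * Y x) * \<rho> x \<partial>M)"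
proof (induction m arbitrary: n)
  note I = integrable_moment[OF assms]
  case 0
  have "integrable M (\<lambda>x. Y x ^ n * \<rho> x)" for n using I[of n 0] by simp
  from this[of n] this[of "Suc n"] have "(neg_diff ^^ Suc 0) (\<lambda>n. real (Suc n) * (\<integral>x. Y x ^ n * \<rho> x \<partial>M)) n =
     (\<integral>x. real (Suc n) * (Y x ^ n * \<rho> x) - real (Suc (Suc n)) * (Y x ^ Suc n * \<rho> x) \<partial>M)"
    by (simp add: neg_diff_def)
  also have "\<dots> = (\<integral>x. Y x ^ n * (1 - Y x) ^ 0 * (real (n + 1) - real (n + 0 + 2) * Y x) * \<rho> x \<partial>M)"
    by (intro Bochner_Integration.integral_cong refl) (simp add: algebra_simps)
  finally show ?case .
next
  note I = integrable_moment[OF assms]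
  have I': "integrable M (\<lambda>x. Y x ^ n * (1 - Y x) ^ m * (a - b * Y x) * \<rho> x)" for n m a b
  proof -
    have "integrable M (\<lambda>x. a * (Y x ^ n * (1 - Y x) ^ m * \<rho> x) - b * (Y x ^ Suc n * (1 - Y x) ^ m * \<rho> x))"
      by (intro Bochner_Integration.integrable_diff integrable_mult_right I)
    then show ?thesis by (rule Bochner_Integration.integrable_cong[THEN iffD1, rotated 2])
       (auto simp: algebra_simps)
  qed
  case (Suc m)
  have "(neg_diff ^^ Suc (Suc m)) (\<lambda>n. real (Suc n) * (\<integral>x. Y x ^ n * \<rho> x \<partial>M)) n
      = (\<integral>x. Y x ^ n * (1 - Y x) ^ m * (real (n + 1) - real (n + m + 2) * Y x) * \<rho> x \<partial>M)
       - (\<integral>x. Y x ^ Suc n * (1 - Y x) ^ m * (real (Suc n + 1) - real (Suc n + m + 2) * Y x) * \<rho> x \<partial>M)"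
    unfolding Suc[symmetric] by (simp add: neg_diff_def)
  also have "\<dots> = (\<integral>x. Y x ^ n * (1 - Y x) ^ m * (real (n + 1) - real (n + m + 2) * Y x) * \<rho> x
       - Y x ^ Suc n * (1 - Y x) ^ m * (real (Suc n + 1) - real (Suc n + m + 2) * Y x) * \<rho> x \<partial>M)"
    by (rule Bochner_Integration.integral_diff[symmetric, OF I' I'])
  also have "\<dots> = (\<integral>x. Y x ^ n * (1 - Y x) ^ Suc m * (real (n + 1) - real (n + Suc m + 2) * Y x) * \<rho> x \<partial>M)"
    by (intro Bochner_Integration.integral_cong refl) (simp add: algebra_simps)
  finally show ?case .
qed

lemma laplace_as_moment:
  "laplace f (real (Suc n)) = (\<integral>x. exp (- x) ^ n * (indicator {0<..} x * (exp (- x) * f x)) \<partial>lebesgue)"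
proof -
  have "exp (- real (Suc n) * x) = exp (- x) ^ n * exp (- x)" for x :: real
    by (simp add: exp_of_nat_mult[symmetric] mult_exp_exp algebra_simps)
  then show ?thesis
    unfolding laplace_def set_lebesgue_integral_def
    by (intro Bochner_Integration.integral_cong refl) (simp add: mult_ac)
qed

lemma measurable_ident_lebesgue: "(\<lambda>x. x) \<in> borel_measurable (lebesgue :: real measure)"
  by (intro measurable_completion) measurable

lemma measurable_exp_uminus: "(\<lambda>x::real. exp (- x)) \<in> borel_measurable lebesgue"
  by (intro measurable_completion) measurable

lemma laplace_exists_one_iff:
  "laplace_exists f 1 \<longleftrightarrow> integrable lebesgue (\<lambda>x. indicator {0<..} x * (exp (- x) * f x))"
  by (simp add: laplace_exists_def set_integrable_def)

lemma laplace_one: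
  assumes "s > 0"
  shows "laplace_exists (\<lambda>t. 1) s" "laplace (\<lambda>t. 1) s = 1 / s"
proof -
  have I: "((\<lambda>t. exp (- s * t)) has_integral 1 / s) {0<..}"
    using has_integral_exp_minus_to_infinity[OF assms, of 0]
    by (simp, subst has_integral_spike_set_eq[where T = "{0..}"])
       (auto intro: negligible_subset[of "{0}"])
  have A: "(\<lambda>t. exp (- s * t)) absolutely_integrable_on {0<..}"
    using I by (intro nonnegative_absolutely_integrable_1) auto
  then show "laplace_exists (\<lambda>t. 1) s" by (simp add: laplace_exists_def)
  show "laplace (\<lambda>t. 1) s = 1 / s"
    using set_lebesgue_integral_eq_integral(2)[OF A] I by (simp add: laplace_def integral_unique)
qed

lemma completely_monotone_antimono:
  assumes "completely_monotone f" "0 < x" "x \<le> y"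
  shows "f y \<le> f x"
proof (rule DERIV_nonpos_imp_nonincreasing[OF assms(3)])
  fix t assume "x \<le> t" "t \<le> y"
  then have t: "t > 0" using assms by auto
  have "f differentiable (at t)" "(- 1) ^ 1 * (deriv ^^ 1) f t \<ge> 0"
    using assms(1) t unfolding completely_monotone_def by (metis funpow_0, blast)
  then show "\<exists>D. DERIV f t :> D \<and> D \<le> 0"
    by (intro exI[of _ "deriv f t"]) (auto simp: DERIV_deriv_iff_real_differentiable)
qed

text \<open>The Bernstein property of \<open>s \<mapsto> s * laplace f s\<close> in terms of differences. The weight \<open>R\<close> changes sign at \<open>c\<close> only, and
\<open>f x - f c\<close> has the opposite sign, so putting the constant \<open>f c\<close> for \<open>f\<close> can only increase the integral.
For a constant the expression vanishes, since \<open>s * laplace 1 s = 1\<close> does not depend on \<open>s\<close>.\<close>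

lemma neg_diff_laplace_antimono:
  assumes ex: "laplace_exists f 1" and mono: "\<And>x y. 0 < x \<Longrightarrow> x \<le> y \<Longrightarrow> f y \<le> f x"
  shows "(neg_diff ^^ Suc m) (\<lambda>n. real (Suc n) * laplace f (real (Suc n))) n \<le> 0"
proof -
  \<comment> \<open>the zero of the last factor of \<open>R\<close> below\<close>
  define c where "c = ln (real (n + m + 2) / real (n + 1))"
  have "real (n + m + 2) / real (n + 1) > 1" by simp
  then have c: "c > 0" unfolding c_def by (rule ln_gt_zero)
  have ec: "exp (- c) = real (n + 1) / real (n + m + 2)"
    unfolding c_def by (simp add: exp_minus)
  define R where "R x = exp (- x) ^ n * (1 - exp (- x)) ^ m * (real (n + 1) - real (n + m + 2) * exp (- x))" for x :: real
  note Ym = measurable_exp_uminus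
  have eq: "(neg_diff ^^ Suc m) (\<lambda>n. real (Suc n) * laplace h (real (Suc n))) n =
      (\<integral>x. R x * (indicator {0<..} x * (exp (- x) * h x)) \<partial>lebesgue)"
    if h: "laplace_exists h 1" for h
    unfolding laplace_as_moment R_def
    by (rule neg_diff_moments_weighted[OF Ym]) (use h in \<open>auto simp: laplace_exists_one_iff indicator_def split: if_splits\<close>)
  have int: "integrable lebesgue (\<lambda>x. R x * (indicator {0<..} x * (exp (- x) * h x)))"
    if h: "laplace_exists h 1" for h
  proof -
    have I: "integrable lebesgue (\<lambda>x. exp (- x) ^ k * (1 - exp (- x)) ^ l * (indicator {0<..} x * (exp (- x) * h x)))" for k l
      by (rule integrable_moment[OF Ym]) (use h in \<open>auto simp: laplace_exists_one_iff indicator_def split: if_splits\<close>)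
    have "integrable lebesgue (\<lambda>x. real (n + 1) * (exp (- x) ^ n * (1 - exp (- x)) ^ m * (indicator {0<..} x * (exp (- x) * h x)))
       - real (n + m + 2) * (exp (- x) ^ Suc n * (1 - exp (- x)) ^ m * (indicator {0<..} x * (exp (- x) * h x))))"
      by (intro Bochner_Integration.integrable_diff integrable_mult_right I)
    then show ?thesis unfolding R_def
      by (rule Bochner_Integration.integrable_cong[THEN iffD1, rotated 2]) (auto simp: algebra_simps)
  qed
  have one: "(\<integral>x. R x * (indicator {0<..} x * (exp (- x) * 1)) \<partial>lebesgue) = 0"
  proof -
    have "(neg_diff ^^ Suc m) (\<lambda>n. real (Suc n) * laplace (\<lambda>t. 1) (real (Suc n))) = (neg_diff ^^ m) (neg_diff (\<lambda>n. 1))"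
      by (simp add: laplace_one(2) funpow_swap1 del: of_nat_Suc)
    also have "neg_diff (\<lambda>n. 1) = (\<lambda>n. 0)" by (auto simp: neg_diff_def)
    also have "(neg_diff ^^ m) (\<lambda>n. 0) = (\<lambda>n. 0)"
      by (induction m) (auto simp: neg_diff_def)
    finally show ?thesis using eq[OF laplace_one(1)] by simp
  qed
  have "(\<integral>x. R x * (indicator {0<..} x * (exp (- x) * f x)) \<partial>lebesgue)
      \<le> (\<integral>x. f c * (R x * (indicator {0<..} x * (exp (- x) * 1))) \<partial>lebesgue)"
  proof (rule integral_mono)
    fix x :: real
    have "R x * f x \<le> R x * f c" if "x > 0"
    proof -
      have pre: "exp (- x) ^ n * (1 - exp (- x)) ^ m \<ge> 0" using that by simp
      have "(real (n + 1) - real (n + m + 2) * exp (- x)) * (f x - f c) \<le> 0"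
      proof (cases "x \<le> c")
        case True
        then have "exp (- c) \<le> exp (- x)" by simp
        then have "real (n + 1) \<le> real (n + m + 2) * exp (- x)"
          unfolding ec by (simp add: field_simps)
        then show ?thesis using mono[OF that True] by (intro mult_nonpos_nonneg) auto
      next
        case False
        then have "exp (- x) \<le> exp (- c)" by simp
        then have "real (n + 1) \<ge> real (n + m + 2) * exp (- x)"
          unfolding ec by (simp add: field_simps)
        then show ?thesis using mono[OF c, of x] False by (intro mult_nonneg_nonpos) auto
      qed
      then have "exp (- x) ^ n * (1 - exp (- x)) ^ m * ((real (n + 1) - real (n + m + 2) * exp (- x)) * (f x - f c)) \<le> 0"
        by (rule mult_nonneg_nonpos[OF pre])
      then have "R x * (f x - f c) \<le> 0" unfolding R_def mult.assoc .
      then show ?thesis by (simp add: right_diff_distrib)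
    qed
    then show "R x * (indicator {0<..} x * (exp (- x) * f x)) \<le> f c * (R x * (indicator {0<..} x * (exp (- x) * 1)))"
      using mult_right_mono[of "R x * f x" "R x * f c" "exp (- x)"]
      by (auto simp: indicator_def mult_ac)
  qed (use int[OF ex] int[OF laplace_one(1)] in auto)
  then show ?thesis using eq[OF ex] one by simp
qed

lemma laplace_nonneg: "(\<And>t. t > 0 \<Longrightarrow> 0 \<le> f t) \<Longrightarrow> 0 \<le> laplace f s"
  unfolding laplace_def set_lebesgue_integral_def
  by (intro Bochner_Integration.integral_nonneg) (auto simp: indicator_def)

text \<open>The terms \<open>a / s\<close> and \<open>b\<close> of the Stieltjes representation contribute \<open>a + b s\<close> to \<open>s * laplace k s\<close>,
whose difference is the constant \<open>b\<close>.\<close>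

lemma kernel_differences_cm:
  assumes "admissible_kernel k"
  shows "cm_upto m (\<lambda>n. real (Suc (Suc n)) * laplace k (real (Suc (Suc n))) - real (Suc n) * laplace k (real (Suc n)))"
proof -
  obtain a b \<psi> where ab: "a \<ge> 0" "b \<ge> 0" and \<psi>: "completely_monotone \<psi>" "\<forall>s>0. laplace_exists \<psi> s"
    and k: "\<forall>s>0. laplace k s = a / s + b + laplace \<psi> s"
    using assms unfolding admissible_kernel_def stieltjes_def by blast
  define h where "h n = real (Suc n) * laplace \<psi> (real (Suc n))" for n
  have "cm_upto m (\<lambda>n. - neg_diff h n)"
  proof (rule cm_uptoI)
    fix j n
    have neg: "(neg_diff ^^ j) (\<lambda>n. - u n) = (\<lambda>n. - (neg_diff ^^ j) u n)" for u
      by (induction j) (auto simp: neg_diff_def)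
    have "(neg_diff ^^ Suc j) h n \<le> 0"
      unfolding h_def by (rule neg_diff_laplace_antimono) (use \<psi> completely_monotone_antimono in auto)
    then show "0 \<le> (neg_diff ^^ j) (\<lambda>n. - neg_diff h n) n"
      unfolding neg by (simp add: funpow_swap1)
  qed
  then have "cm_upto m (\<lambda>n. b + - neg_diff h n)" by (intro cm_upto_add cm_upto_const ab)
  moreover have "real (Suc n) * laplace k (real (Suc n)) = a + b * real (Suc n) + h n" for n
    using k by (simp add: h_def field_simps)
  then have "real (Suc (Suc n)) * laplace k (real (Suc (Suc n))) - real (Suc n) * laplace k (real (Suc n))
      = b + - neg_diff h n" for n
    by (simp only: neg_diff_def) (simp add: algebra_simps)
  ultimately show ?thesis by simp
qed

text \<open>The impulse response is nonnegative, expressed by its Hausdorff moments with respect to \<open>exp (- x)\<close>.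
Its pointwise values are not determined by its Laplace transform, so only integrals against test
functions are used below.\<close>

lemma impulse_moments_nonneg:
  assumes k: "admissible_kernel k" and v: "impulse_response k v" and c: "c > 0"
  shows "0 \<le> (\<integral>x. exp (- x) ^ n * (1 - exp (- x)) ^ m * (indicator {0<..} x * (exp (- x) * v x c)) \<partial>lebesgue)"
proof -
  have ex: "laplace_exists (\<lambda>t. v t c) 1"
    and L: "\<And>s. s > 0 \<Longrightarrow> laplace (\<lambda>t. v t c) s = 1 / (s * laplace k s + c)"
    using v c unfolding impulse_response_def by auto
  have "laplace k s \<ge> 0" for s
    using k unfolding admissible_kernel_def by (intro laplace_nonneg) auto
  then have "cm_upto m (\<lambda>n. 1 / (real (Suc n) * laplace k (real (Suc n)) + c))"
    by (intro cm_upto_inverse[OF c _ kernel_differences_cm[OF k]]) auto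
  then have "0 \<le> (neg_diff ^^ m) (\<lambda>n. laplace (\<lambda>t. v t c) (real (Suc n))) n"
    using cm_upto_iterate_nonneg L by simp
  also have "\<dots> = (\<integral>x. exp (- x) ^ n * (1 - exp (- x)) ^ m * (indicator {0<..} x * (exp (- x) * v x c)) \<partial>lebesgue)"
    unfolding laplace_as_moment
    by (rule neg_diff_moments[OF measurable_exp_uminus]) (use ex in \<open>auto simp: laplace_exists_one_iff indicator_def split: if_splits\<close>)
  finally show ?thesis .
qed

section \<open>Convolution on a bounded interval\<close>

lemma lebesgue_integral_reflect:
  fixes f :: "real \<Rightarrow> real"
  assumes "f \<in> borel_measurable lebesgue"
  shows "(\<integral>x. f (t - x) \<partial>lebesgue) = (\<integral>x. f x \<partial>lebesgue)"
proof -
  have m: "(\<lambda>x. t - x) \<in> lebesgue \<rightarrow>\<^sub>M (lebesgue :: real measure)"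
    using lebesgue_affine_measurable[where c = "\<lambda>_. - 1" and t = t] by simp
  have "lebesgue = distr lebesgue lebesgue (\<lambda>x. t - x)"
    using lebesgue_real_affine[of "- 1" t] by (simp add: density_1)
  then have "(\<integral>x. f x \<partial>lebesgue) = (\<integral>x. f x \<partial>distr lebesgue lebesgue (\<lambda>x. t - x))" by simp
  also have "\<dots> = (\<integral>x. f (t - x) \<partial>lebesgue)" by (rule integral_distr[OF m assms])
  finally show ?thesis by simp
qed

text \<open>Extension of a function on \<open>[0, T]\<close> by its boundary values, to have it continuous on the line.\<close>

definition const_ext :: "real \<Rightarrow> (real \<Rightarrow> real) \<Rightarrow> real \<Rightarrow> real" where
  "const_ext T h x = h (max 0 (min T x))"

lemma const_ext_eq: "0 \<le> x \<Longrightarrow> x \<le> T \<Longrightarrow> const_ext T h x = h x"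
  by (simp add: const_ext_def)

lemma continuous_const_ext:
  assumes "T \<ge> 0" "continuous_on {0..T} h"
  shows "continuous_on UNIV (const_ext T h)"
  unfolding const_ext_def
  by (rule continuous_on_compose2[OF assms(2)]) (use assms(1) in \<open>auto intro!: continuous_intros\<close>)

lemma const_ext_bounded:
  assumes "T \<ge> 0" "continuous_on {0..T} h"
  obtains C where "C \<ge> 0" "\<And>x. \<bar>const_ext T h x\<bar> \<le> C"
proof -
  obtain C where C: "\<And>y. y \<in> {0..T} \<Longrightarrow> \<bar>h y\<bar> \<le> C"
    using compact_continuous_image[OF assms(2)]
    by (force simp: bounded_iff dest!: compact_imp_bounded)
  have b: "\<bar>const_ext T h x\<bar> \<le> C" for x
    unfolding const_ext_def using assms(1) by (intro C) auto
  moreover have "C \<ge> 0" using b[of 0] by linarith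
  ultimately show thesis using that by blast
qed

lemma measurable_const_ext_shift:
  assumes "T \<ge> 0" "continuous_on {0..T} h"
  shows "(\<lambda>x. const_ext T h (t - x)) \<in> borel_measurable lebesgue"
proof -
  have "continuous_on UNIV (\<lambda>x. const_ext T h (t - x))"
    by (rule continuous_on_compose2[OF continuous_const_ext[OF assms]]) (auto intro!: continuous_intros)
  then show ?thesis by (intro measurable_completion) (simp add: borel_measurable_continuous_onI)
qed

text \<open>The weight \<open>exp (- x)\<close> is bounded away from zero on bounded intervals.\<close>

lemma integrable_truncated:
  fixes a h :: "real \<Rightarrow> real"
  assumes a: "integrable lebesgue (\<lambda>x. indicator {0<..} x * (exp (- x) * a x))"
    and h: "h \<in> borel_measurable lebesgue" "\<And>x. \<bar>h x\<bar> \<le> (C::real)"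
  shows "integrable lebesgue (\<lambda>x. indicator {0<..<T} x * a x * h x)"
proof -
  have "integrable lebesgue (\<lambda>x. indicator {..<T} x * h x * exp x * (indicator {0<..} x * (exp (- x) * a x)))"
  proof (rule Bochner_Integration.integrable_bound[OF integrable_mult_right[OF a, of "C * exp T"]])
    have "exp \<in> borel_measurable (lebesgue :: real measure)" by (intro measurable_completion) measurable
    moreover have "indicator {..<T} \<in> borel_measurable (lebesgue :: real measure)"
      by (intro measurable_completion) measurable
    ultimately show "(\<lambda>x. indicator {..<T} x * h x * exp x * (indicator {0<..} x * (exp (- x) * a x))) \<in> borel_measurable lebesgue"
      using h(1) by (intro borel_measurable_times[OF borel_measurable_times[OF borel_measurable_times]
          borel_measurable_integrable[OF a]])
    have C: "C \<ge> 0" using h(2)[of 0] by linarith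
    have "\<bar>indicator {..<T} x * h x * exp x\<bar> \<le> C * exp T" for x
      using h(2)[of x] C by (auto simp: indicator_def abs_mult intro!: mult_mono)
    then show "AE x in lebesgue. norm (indicator {..<T} x * h x * exp x * (indicator {0<..} x * (exp (- x) * a x)))
        \<le> norm (C * exp T * (indicator {0<..} x * (exp (- x) * a x)))"
      using C by (intro AE_I2) (simp add: abs_mult[of "indicator {..<T} _ * _ * _"] abs_mult[of "C * exp T"] mult_right_mono del: abs_mult)
  qed
  then show ?thesis
    by (rule Bochner_Integration.integrable_cong[THEN iffD1, rotated 2])
       (auto simp: indicator_def exp_minus)
qed

lemma integrable_truncated_convol:
  fixes a h :: "real \<Rightarrow> real"
  assumes a: "integrable lebesgue (\<lambda>x. indicator {0<..} x * (exp (- x) * a x))"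
    and h: "continuous_on {0..T} h" and t: "0 \<le> t" "t \<le> T"
  shows "integrable lebesgue (\<lambda>x. indicator {0<..<t} x * a x * h (t - x))"
proof -
  have T: "0 \<le> T" using t by linarith
  obtain C where "\<And>x. \<bar>const_ext T h x\<bar> \<le> C" using const_ext_bounded[OF T h] by blast
  from integrable_truncated[OF a measurable_const_ext_shift[OF T h] this]
  have "integrable lebesgue (\<lambda>x. indicator {0<..<t} x * a x * const_ext T h (t - x))" .
  then show ?thesis
    by (rule Bochner_Integration.integrable_cong[THEN iffD1, rotated 2])
       (use t in \<open>auto simp: indicator_def const_ext_eq\<close>)
qed

lemma integrable_truncated_continuous:
  fixes a h :: "real \<Rightarrow> real"
  assumes a: "integrable lebesgue (\<lambda>x. indicator {0<..} x * (exp (- x) * a x))"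
    and h: "continuous_on {0..T} h" and t: "0 \<le> T"
  shows "integrable lebesgue (\<lambda>x. indicator {0<..<T} x * a x * h x)"
proof -
  have "continuous_on {0..T} (\<lambda>x. h (T - x))"
    by (rule continuous_on_compose2[OF h]) (auto intro!: continuous_intros)
  from integrable_truncated_convol[OF a this t] show ?thesis by simp
qed

text \<open>The integrability hypothesis says nothing about \<open>a 0\<close>, which enters the defining integral at the
end point \<open>t\<close> only; so the closed interval is traded for the open one.\<close>

lemma convol_eq:
  fixes a h :: "real \<Rightarrow> real"
  assumes a: "integrable lebesgue (\<lambda>x. indicator {0<..} x * (exp (- x) * a x))"
    and h: "continuous_on {0..T} h" and t: "0 \<le> t" "t \<le> T"
  shows "convol a h t = (\<integral>x. indicator {0<..<t} x * a x * h (t - x) \<partial>lebesgue)"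
proof -
  let ?g = "\<lambda>x. indicator {0<..<t} x * a x * h (t - x)"
  \<comment> \<open>the terms at the two end points, which coincide when \<open>t = 0\<close>\<close>
  let ?e = "\<lambda>x. indicator {0} x * (a t * h 0) + indicator {t} x * (if t = 0 then 0 else a 0 * h t)"
  note g = borel_measurable_integrable[OF integrable_truncated_convol[OF assms]]
  have m: "(\<lambda>x. t - x) \<in> lebesgue \<rightarrow>\<^sub>M (lebesgue :: real measure)"
    using lebesgue_affine_measurable[where c = "\<lambda>_. - 1" and t = t] by simp
  have g': "(\<lambda>x. ?g (t - x)) \<in> borel_measurable lebesgue"
    using measurable_compose[OF m g] .
  have e: "?e \<in> borel_measurable lebesgue"
    by (intro measurable_completion) measurable
  have eq: "indicator {0..t} x * (a (t - x) * h x) = ?g (t - x) + ?e x" for x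
    using t by (auto simp: indicator_def)
  have "convol a h t = (\<integral>x. indicator {0..t} x * (a (t - x) * h x) \<partial>lebesgue)"
    by (simp add: convol_def set_lebesgue_integral_def)
  also have "\<dots> = (\<integral>x. ?g (t - x) \<partial>lebesgue)"
  proof (rule integral_cong_AE)
    show "(\<lambda>x. indicator {0..t} x * (a (t - x) * h x)) \<in> borel_measurable lebesgue"
      unfolding eq using g' e by (rule borel_measurable_add)
    have "AE x in lebesgue. x \<notin> {0, t}"
      by (rule AE_not_in) (simp flip: negligible_iff_null_sets)
    then show "AE x in lebesgue. indicator {0..t} x * (a (t - x) * h x) = ?g (t - x)"
      unfolding eq by eventually_elim auto
  qed (rule g')
  also have "\<dots> = (\<integral>x. ?g x \<partial>lebesgue)" by (rule lebesgue_integral_reflect[OF g])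
  finally show ?thesis .
qed

section \<open>Lower bound for the response to a positive source\<close>

text \<open>Since \<open>v\<close> is nonnegative, the mass of \<open>v\<close> on \<open>[0, T]\<close> is at least the Laplace transform at a large
\<open>s\<close> minus the contribution of \<open>[T, \<infinity>)\<close>, and the latter is exponentially small in \<open>s\<close> compared with
the Laplace transform at \<open>1\<close>. Positivity of \<open>v\<close> is applied twice, to the function \<open>q (T - x) - q0 p (x)\<close>
on \<open>[0, T)\<close> and to the negative part of \<open>p\<close>, which lives on \<open>[T, \<infinity>)\<close>.\<close>

lemma impulse_convol_lower_bound:
  fixes q :: "real \<Rightarrow> real"
  assumes k: "admissible_kernel k" and v: "impulse_response k v" and c: "c > 0" and T: "T > 0"
    and q: "continuous_on {0..T} q" "q0 > 0" "\<And>t. t \<in> {0..T} \<Longrightarrow> q0 \<le> q t"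
  shows "q0 * (laplace (\<lambda>t. v t c) (real (Suc N)) - exp (- real N * T) * laplace (\<lambda>t. v t c) 1)
           \<le> convol (\<lambda>t. v t c) q T"
proof -
  define a where "a x = v x c" for x
  define E where "E = exp (- real N * T)"
  \<comment> \<open>\<open>p\<close> lies in \<open>[0, 1]\<close> before time \<open>T\<close> and is nonpositive after it; its integral against \<open>v\<close> combines two values of the Laplace transform.\<close>
  define p where "p x = exp (- x) * (exp (- x) ^ N - E)" for x :: real
  have ex: "integrable lebesgue (\<lambda>x. indicator {0<..} x * (exp (- x) * a x))"
    using v c laplace_exists_one_iff[of a] unfolding impulse_response_def a_def by auto
  have mom: "0 \<le> (\<integral>x. exp (- x) ^ n * (1 - exp (- x)) ^ m * (indicator {0<..} x * (exp (- x) * a x)) \<partial>lebesgue)" for n m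
    using impulse_moments_nonneg[OF k v c] unfolding a_def .
  have pc: "continuous_on S p" for S unfolding p_def by (intro continuous_intros)
  have qc: "continuous_on {0..T} (\<lambda>x. q (T - x))"
    by (rule continuous_on_compose2[OF q(1)]) (auto intro!: continuous_intros)
  have eN: "exp (- x) ^ N = exp (- real N * x)" for x :: real
    by (simp add: exp_of_nat_mult[symmetric])
  have p0: "p x \<ge> 0" if "x \<le> T" for x
    unfolding p_def E_def eN using mult_left_mono[OF that, of "real N"] by simp
  have p1: "p x \<le> 1" if "x \<ge> 0" for x
  proof -
    have "exp (- x) ^ N \<le> 1" "E \<ge> 0" using that by (auto simp: E_def power_le_one)
    then have "exp (- x) ^ N - E \<le> 1" by linarith
    then have "p x \<le> exp (- x) * 1" unfolding p_def by (intro mult_left_mono) auto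
    then show ?thesis using that by (simp add: order_trans[of _ "exp (- x)" 1])
  qed
  have neg: "p x \<le> 0" if "x \<ge> T" for x
    unfolding p_def E_def eN using that by (intro mult_nonneg_nonpos) (auto intro: mult_left_mono)
  note idm = measurable_ident_lebesgue
  have "(\<integral>x. indicator {..<T} x * (q (T - x) - q0 * p x) * 0 \<partial>lebesgue)
      \<le> (\<integral>x. indicator {..<T} x * (q (T - x) - q0 * p x) * (indicator {0<..} x * a x) \<partial>lebesgue)"
  proof (rule moment_comparison_halfline[where Z = "\<lambda>x. x" and Z' = "\<lambda>x. x" and p = "\<lambda>x. q (T - x) - q0 * p x"])
    show "continuous_on {0..T} (\<lambda>x. q (T - x) - q0 * p x)"
      by (intro continuous_intros qc pc)
    fix x assume "x \<in> {0..T}"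
    then have "q0 \<le> q (T - x)" "q0 * p x \<le> q0" using q(2,3) p1[of x] by auto
    then show "0 \<le> q (T - x) - q0 * p x" by linarith
  qed (use idm ex mom T in \<open>auto simp: mult_ac indicator_def split: if_splits\<close>)
  also have "\<dots> = (\<integral>x. indicator {0<..<T} x * a x * q (T - x) - q0 * (indicator {0<..<T} x * a x * p x) \<partial>lebesgue)"
    by (intro Bochner_Integration.integral_cong refl) (auto simp: indicator_def algebra_simps)
  also have "\<dots> = (\<integral>x. indicator {0<..<T} x * a x * q (T - x) \<partial>lebesgue) - q0 * (\<integral>x. indicator {0<..<T} x * a x * p x \<partial>lebesgue)"
    using integrable_truncated_continuous[OF ex qc] integrable_truncated_continuous[OF ex pc, of T] T by simp
  finally have 1: "q0 * (\<integral>x. indicator {0<..<T} x * a x * p x \<partial>lebesgue) \<le> convol a q T"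
    using convol_eq[OF ex q(1), of T] T by simp
  have "(\<integral>x. max 0 (E - exp (- x) ^ N) * 0 \<partial>lebesgue)
      \<le> (\<integral>x. max 0 (E - exp (- x) ^ N) * (indicator {0<..} x * (exp (- x) * a x)) \<partial>lebesgue)"
    by (rule moment_comparison[where Y = "\<lambda>x. exp (- x)" and Y' = "\<lambda>x. exp (- x)" and F = "\<lambda>y. max 0 (E - y ^ N)"])
       (use measurable_exp_uminus ex mom in \<open>auto simp: indicator_def intro!: continuous_intros split: if_splits\<close>)
  also have "\<dots> = (\<integral>x. E * (indicator {0<..} x * (exp (- x) * a x))
       - exp (- x) ^ N * (indicator {0<..} x * (exp (- x) * a x)) + indicator {0<..<T} x * a x * p x \<partial>lebesgue)"
  proof (intro Bochner_Integration.integral_cong refl)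
    fix x :: real
    have "max 0 (E - exp (- x) ^ N) * exp (- x) = E * exp (- x) - exp (- x) ^ N * exp (- x) + indicator {..<T} x * p x"
    proof (cases "x < T")
      case True
      then have "E - exp (- x) ^ N \<le> 0" using p0[of x] unfolding p_def by (simp add: zero_le_mult_iff)
      then show ?thesis using True by (simp add: max_absorb1 p_def algebra_simps)
    next
      case False
      then have "E - exp (- x) ^ N \<ge> 0" using neg[of x] unfolding p_def by (simp add: mult_le_0_iff)
      then show ?thesis using False by (simp add: max_absorb2 algebra_simps)
    qed
    then have "max 0 (E - exp (- x) ^ N) * exp (- x) * (indicator {0<..} x * a x)
        = (E * exp (- x) - exp (- x) ^ N * exp (- x) + indicator {..<T} x * p x) * (indicator {0<..} x * a x)" by simp
    then show "max 0 (E - exp (- x) ^ N) * (indicator {0<..} x * (exp (- x) * a x)) =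
      E * (indicator {0<..} x * (exp (- x) * a x)) - exp (- x) ^ N * (indicator {0<..} x * (exp (- x) * a x))
       + indicator {0<..<T} x * a x * p x"
      by (auto simp: indicator_def algebra_simps)
  qed
  also have "\<dots> = E * laplace a 1 - laplace a (real (Suc N)) + (\<integral>x. indicator {0<..<T} x * a x * p x \<partial>lebesgue)"
  proof -
    have "integrable lebesgue (\<lambda>x. exp (- x) ^ N * (1 - exp (- x)) ^ 0 * (indicator {0<..} x * (exp (- x) * a x)))"
      by (rule integrable_moment[OF measurable_exp_uminus ex]) (auto simp: indicator_def split: if_splits)
    then show ?thesis
      using integrable_truncated_continuous[OF ex pc, of T] T ex laplace_as_moment[of a 0] laplace_as_moment[of a N] by simp
  qed
  finally have "laplace a (real (Suc N)) - E * laplace a 1 \<le> (\<integral>x. indicator {0<..<T} x * a x * p x \<partial>lebesgue)"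
    by simp
  then have "q0 * (laplace a (real (Suc N)) - E * laplace a 1) \<le> q0 * (\<integral>x. indicator {0<..<T} x * a x * p x \<partial>lebesgue)"
    using q(2) by (intro mult_left_mono) auto
  with 1 show ?thesis unfolding a_def E_def by linarith
qed

text \<open>As \<open>laplace k\<close> tends to zero, \<open>s * laplace k s \<le> s\<close> for large \<open>s\<close>, so the first term of the preceding
bound decays like \<open>1 / s\<close> at worst and wins over the exponential. After multiplication by \<open>c\<close> the first
term increases in \<open>c\<close> and the second stays bounded, which makes the choice of \<open>N\<close> uniform.\<close>

lemma impulse_convol_uniform_lower_bound:
  fixes q :: "real \<Rightarrow> real"
  assumes k: "admissible_kernel k" and v: "impulse_response k v" and c0: "c0 > 0" and T: "T > 0"
    and q: "continuous_on {0..T} q" "q0 > 0" "\<And>t. t \<in> {0..T} \<Longrightarrow> q0 \<le> q t"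
  shows "\<exists>C>0. \<forall>c\<ge>c0. C / c \<le> convol (\<lambda>t. v t c) q T"
proof -
  have "eventually (\<lambda>s. laplace k s < 1) at_top"
    using k unfolding admissible_kernel_def by (auto intro: order_tendstoD)
  then have "eventually (\<lambda>N. laplace k (real (Suc N)) < 1) sequentially"
    by (rule eventually_compose_filterlim)
       (intro filterlim_compose[OF filterlim_real_sequentially] filterlim_Suc)
  moreover have "eventually (\<lambda>N. exp (- real N * T) < c0 / (real (Suc N) + c0)) sequentially"
    using c0 T by real_asymp
  ultimately obtain N where N: "laplace k (real (Suc N)) < 1" "exp (- real N * T) < c0 / (real (Suc N) + c0)"
    using eventually_happens'[OF sequentially_bot eventually_conj] by blast
  define C where "C = q0 * (c0 / (real (Suc N) + c0) - exp (- real N * T))"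
  have kn: "laplace k s \<ge> 0" for s
    using k unfolding admissible_kernel_def by (intro laplace_nonneg) auto
  have "C / c \<le> convol (\<lambda>t. v t c) q T" if c: "c \<ge> c0" for c
  proof -
    have cp: "c > 0" using c c0 by simp
    define g where "g = real (Suc N) * laplace k (real (Suc N))"
    have g: "0 \<le> g" "g \<le> real (Suc N)" using kn N(1) by (auto simp: g_def mult_left_le simp del: of_nat_Suc)
    have L: "laplace (\<lambda>t. v t c) s = 1 / (s * laplace k s + c)" if "s > 0" for s
      using v cp that unfolding impulse_response_def by auto
    have "c0 / (real (Suc N) + c0) \<le> c / (real (Suc N) + c)"
      using c c0 by (simp add: divide_simps) (simp add: algebra_simps add_mono mult_right_mono)
    also have "\<dots> \<le> c / (g + c)" using g cp by (intro divide_left_mono) auto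
    finally have "c0 / (real (Suc N) + c0) \<le> c * laplace (\<lambda>t. v t c) (real (Suc N))"
      using L[of "real (Suc N)"] by (simp add: g_def)
    moreover have "c * laplace (\<lambda>t. v t c) 1 \<le> 1"
      using L[of 1] kn[of 1] cp by (simp add: divide_le_eq add_nonneg_pos)
    then have "exp (- real N * T) * (c * laplace (\<lambda>t. v t c) 1) \<le> exp (- real N * T) * 1"
      by (intro mult_left_mono) auto
    moreover have "c * (laplace (\<lambda>t. v t c) (real (Suc N)) - exp (- real N * T) * laplace (\<lambda>t. v t c) 1)
        = c * laplace (\<lambda>t. v t c) (real (Suc N)) - exp (- real N * T) * (c * laplace (\<lambda>t. v t c) 1)"
      by (simp add: algebra_simps)
    ultimately have "c0 / (real (Suc N) + c0) - exp (- real N * T)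
        \<le> c * (laplace (\<lambda>t. v t c) (real (Suc N)) - exp (- real N * T) * laplace (\<lambda>t. v t c) 1)"
      by linarith
    then have "C \<le> q0 * (c * (laplace (\<lambda>t. v t c) (real (Suc N)) - exp (- real N * T) * laplace (\<lambda>t. v t c) 1))"
      unfolding C_def using q(2) by (intro mult_left_mono) auto
    also have "\<dots> \<le> c * convol (\<lambda>t. v t c) q T"
      using mult_left_mono[OF impulse_convol_lower_bound[OF k v cp T q, of N], of c] cp by (simp add: mult_ac)
    finally show ?thesis using cp by (simp add: field_simps)
  qed
  moreover have "C > 0" unfolding C_def using N(2) q(2) by simp
  ultimately show ?thesis by blast
qed

section \<open>The relaxation equation\<close>

lemma sigma_finite_lebesgue: "sigma_finite_measure (lebesgue :: 'b::euclidean_space measure)"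
proof
  obtain A :: "'b set set" where "countable A" "A \<subseteq> sets lborel" "\<Union>A = space lborel" "\<forall>a\<in>A. emeasure lborel a \<noteq> \<infinity>"
    using lborel.sigma_finite_countable by blast
  then show "\<exists>A::'b set set. countable A \<and> A \<subseteq> sets lebesgue \<and> \<Union>A = space lebesgue \<and> (\<forall>a\<in>A. emeasure lebesgue a \<noteq> \<infinity>)"
    by (intro exI[of _ A]) auto
qed

interpretation lebesgue_pair: pair_sigma_finite "lebesgue :: real measure" "lebesgue :: real measure"
  by (simp add: pair_sigma_finite_def sigma_finite_lebesgue)

lemma lebesgue_product:
  fixes f g :: "real \<Rightarrow> real"
  assumes f: "integrable lebesgue f" and g: "integrable lebesgue g"
  shows "integrable (lebesgue \<Otimes>\<^sub>M lebesgue) (\<lambda>z. f (fst z) * g (snd z))"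
    and "(\<integral>z. f (fst z) * g (snd z) \<partial>(lebesgue \<Otimes>\<^sub>M lebesgue)) = (\<integral>x. f x \<partial>lebesgue) * (\<integral>x. g x \<partial>lebesgue)"
proof -
  note [measurable] = borel_measurable_integrable[OF f] borel_measurable_integrable[OF g]
  show I: "integrable (lebesgue \<Otimes>\<^sub>M lebesgue) (\<lambda>z. f (fst z) * g (snd z))"
  proof (rule lebesgue_pair.Fubini_integrable)
    show "integrable lebesgue (\<lambda>x. \<integral>y. norm (f (fst (x, y)) * g (snd (x, y))) \<partial>lebesgue)"
      using f by (simp add: abs_mult)
  qed (use g in auto)
  show "(\<integral>z. f (fst z) * g (snd z) \<partial>(lebesgue \<Otimes>\<^sub>M lebesgue)) = (\<integral>x. f x \<partial>lebesgue) * (\<integral>x. g x \<partial>lebesgue)"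
    using lebesgue_pair.integral_fst'[OF I] by simp
qed

lemma tendsto_difference_quotient:
  fixes f :: "real \<Rightarrow> real"
  assumes "(f has_real_derivative D) (at x within S)" "h \<longlonglongrightarrow> 0"
    and "eventually (\<lambda>j. h j \<noteq> 0 \<and> x - h j \<in> S) sequentially"
  shows "(\<lambda>j. (f x - f (x - h j)) / h j) \<longlonglongrightarrow> D"
proof -
  have "((\<lambda>y. (f y - f x) / (y - x)) \<longlongrightarrow> D) (at x within S)"
    using assms(1) by (simp add: has_field_derivative_iff)
  moreover have "filterlim (\<lambda>j. x - h j) (at x within S) sequentially"
    unfolding filterlim_at
    by (intro conjI eventually_mono[OF assms(3)] tendsto_eq_intros) (auto intro!: tendsto_eq_intros assms(2))
  ultimately have "(\<lambda>j. (f (x - h j) - f x) / (x - h j - x)) \<longlonglongrightarrow> D"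
    by (rule filterlim_compose)
  then show ?thesis
    by (rule Lim_transform_eventually)
       (rule eventually_mono[OF assms(3)], auto simp: field_simps)
qed

lemma convol_one:
  fixes w :: "real \<Rightarrow> real"
  assumes "continuous_on {0..T} w" "0 \<le> t" "t \<le> T"
  shows "(\<integral>x. indicator {0<..<t} x * w (t - x) \<partial>lebesgue) = integral {0..t} w"
proof -
  have ex: "integrable lebesgue (\<lambda>x::real. indicator {0<..} x * (exp (- x) * 1) :: real)"
    using laplace_one(1)[of 1] by (simp add: laplace_exists_one_iff)
  have "(\<integral>x. indicator {0<..<t} x * w (t - x) \<partial>lebesgue) = convol (\<lambda>x. 1) w t"
    using convol_eq[OF ex assms] by simp
  also have "\<dots> = (LINT x:{0..t}|lebesgue. w x)" by (simp add: convol_def)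
  also have "\<dots> = integral {0..t} w"
    using assms continuous_on_subset[OF assms(1), of "{0..t}"]
    by (intro set_lebesgue_integral_eq_integral absolutely_integrable_continuous_real) auto
  finally show ?thesis .
qed

text \<open>Because \<open>w 0 = 0\<close>, extending \<open>w\<close> by zero to negative times keeps it continuous, and the upper limit of
integration may then be frozen at \<open>T\<close>.\<close>

lemma continuous_on_convol:
  fixes a w :: "real \<Rightarrow> real"
  assumes a: "integrable lebesgue (\<lambda>x. indicator {0<..} x * (exp (- x) * a x))"
    and w: "continuous_on {0..T} w" "w 0 = 0"
  shows "continuous_on {0..T} (convol a w)"
proof (cases "T \<ge> 0")
  case T: True
  obtain C where C: "\<And>x. \<bar>const_ext T w x\<bar> \<le> C" using const_ext_bounded[OF T w(1)] by blast
  have eq: "convol a w t = (\<integral>x. indicator {0<..<T} x * a x * const_ext T w (t - x) \<partial>lebesgue)" if "t \<in> {0..T}" for t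
  proof -
    have "convol a w t = (\<integral>x. indicator {0<..<t} x * a x * w (t - x) \<partial>lebesgue)"
      using that by (intro convol_eq[OF a w(1)]) auto
    also have "\<dots> = (\<integral>x. indicator {0<..<T} x * a x * const_ext T w (t - x) \<partial>lebesgue)"
      using that w(2) by (intro Bochner_Integration.integral_cong refl) (auto simp: const_ext_def indicator_def)
    finally show ?thesis .
  qed
  have int: "integrable lebesgue (\<lambda>x. indicator {0<..<T} x * a x * const_ext T w (t - x))" for t
    by (rule integrable_truncated[OF a measurable_const_ext_shift[OF T w(1)] C])
  have "integrable lebesgue (\<lambda>x. indicator {0<..<T} x * a x * 1)"
    by (rule integrable_truncated_continuous[OF a _ T]) auto
  then have dom: "integrable lebesgue (\<lambda>x. C * \<bar>indicator {0<..<T} x * a x\<bar>)" by (auto simp del: abs_mult)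
  have "continuous_on {0..T} (\<lambda>t. \<integral>x. indicator {0<..<T} x * a x * const_ext T w (t - x) \<partial>lebesgue)"
    unfolding continuous_on_sequentially
  proof (intro ballI allI impI, unfold comp_def, elim conjE)
    fix u :: "nat \<Rightarrow> real" and t assume u: "u \<longlonglongrightarrow> t"
    show "(\<lambda>j. \<integral>x. indicator {0<..<T} x * a x * const_ext T w (u j - x) \<partial>lebesgue)
       \<longlonglongrightarrow> (\<integral>x. indicator {0<..<T} x * a x * const_ext T w (t - x) \<partial>lebesgue)"
    proof (rule integral_dominated_convergence[OF _ _ dom])
      have "isCont (const_ext T w) y" for y
        using continuous_const_ext[OF T w(1)] by (simp add: continuous_on_eq_continuous_at)
      then show "AE x in lebesgue. (\<lambda>j. indicator {0<..<T} x * a x * const_ext T w (u j - x))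
          \<longlonglongrightarrow> indicator {0<..<T} x * a x * const_ext T w (t - x)"
        using u by (intro AE_I2 tendsto_mult_left isCont_tendsto_compose[where g = "const_ext T w"] tendsto_diff tendsto_const) auto
      show "AE x in lebesgue. norm (indicator {0<..<T} x * a x * const_ext T w (u j - x)) \<le> C * \<bar>indicator {0<..<T} x * a x\<bar>" for j
        unfolding real_norm_def abs_mult[of _ "const_ext _ _ _"] mult.commute[of C]
        by (intro AE_I2 mult_left_mono C) auto
    qed (use int in auto)
  qed
  then show ?thesis by (subst continuous_on_cong[OF refl eq])
qed auto

lemma measurable_sum_lebesgue_pair:
  "(\<lambda>z. fst z + snd z) \<in> borel_measurable (lebesgue \<Otimes>\<^sub>M lebesgue :: (real \<times> real) measure)"
  by (intro borel_measurable_add measurable_compose[OF measurable_fst measurable_ident_lebesgue]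
      measurable_compose[OF measurable_snd measurable_ident_lebesgue])

text \<open>The product of the Laplace transforms of \<open>v\<close> and \<open>k + c\<close> at \<open>s\<close> is
\<open>(laplace k s + c / s) / (s * laplace k s + c) = 1 / s\<close>, which says that \<open>v\<close> is the resolvent of \<open>k + c\<close>:
their convolution is the constant \<open>1\<close>. The statement compares the law of \<open>x + y\<close> under the product
density with Lebesgue measure on the half-line.\<close>

lemma impulse_resolvent_moments:
  assumes v: "impulse_response k v" and c: "c > 0"
    and k: "\<forall>s>0. laplace_exists k s" "\<And>s. laplace k s \<ge> 0"
  defines "\<rho> \<equiv> \<lambda>z::real \<times> real. indicator {0<..} (fst z) * v (fst z) c * (indicator {0<..} (snd z) * (k (snd z) + c))"
  shows "integrable (lebesgue \<Otimes>\<^sub>M lebesgue) (\<lambda>z. exp (- (fst z + snd z)) * \<rho> z)"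
    and "(\<integral>z. exp (- (fst z + snd z)) ^ n * (1 - exp (- (fst z + snd z))) ^ m * (exp (- (fst z + snd z)) * \<rho> z) \<partial>(lebesgue \<Otimes>\<^sub>M lebesgue))
       = (\<integral>x. exp (- x) ^ n * (1 - exp (- x)) ^ m * (exp (- x) * indicator {0<..} x) \<partial>lebesgue)"
proof -
  let ?V = "\<lambda>x. indicator {0<..} x * (exp (- x) * v x c)"
  let ?K = "\<lambda>x. indicator {0<..} x * (exp (- x) * (k x + c))"
  have V: "integrable lebesgue ?V"
    using v c laplace_exists_one_iff[of "\<lambda>x. v x c"] unfolding impulse_response_def by auto
  have "integrable lebesgue (\<lambda>x. indicator {0<..} x * (exp (- x) * k x) + c * (indicator {0<..} x * (exp (- x) * 1)))"
    using k(1)[rule_format, of 1] laplace_one(1)[of 1] laplace_exists_one_iff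
    by (intro Bochner_Integration.integrable_add integrable_mult_right) auto
  then have K: "integrable lebesgue ?K"
    by (simp add: algebra_simps)
  have e: "exp (- (fst z + snd z)) * \<rho> z = ?V (fst z) * ?K (snd z)" for z
    unfolding \<rho>_def by (simp add: exp_diff exp_minus field_simps)
  show I: "integrable (lebesgue \<Otimes>\<^sub>M lebesgue) (\<lambda>z. exp (- (fst z + snd z)) * \<rho> z)"
    unfolding e by (rule lebesgue_product(1)[OF V K])
  have Km: "integrable lebesgue (\<lambda>x. exp (- x) ^ n * (indicator {0<..} x * (exp (- x) * h x)))"
    if "laplace_exists h 1" for h n
    using integrable_moment[OF measurable_exp_uminus, of "\<lambda>x. indicator {0<..} x * (exp (- x) * h x)" n 0] that
    by (auto simp: laplace_exists_one_iff indicator_def split: if_splits)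
  have mom: "(\<integral>z. exp (- (fst z + snd z)) ^ n * (exp (- (fst z + snd z)) * \<rho> z) \<partial>(lebesgue \<Otimes>\<^sub>M lebesgue)) = 1 / real (Suc n)" for n
  proof -
    have Kn: "(\<lambda>x. exp (- x) ^ n * ?K x) = (\<lambda>x. exp (- x) ^ n * (indicator {0<..} x * (exp (- x) * k x))
          + c * (exp (- x) ^ n * (indicator {0<..} x * (exp (- x) * 1))))"
      by (auto simp: algebra_simps)
    have iK: "integrable lebesgue (\<lambda>x. exp (- x) ^ n * ?K x)"
      unfolding Kn using k(1)[rule_format, of 1] laplace_one(1)[of 1]
      by (intro Bochner_Integration.integrable_add integrable_mult_right Km) auto
    have iV: "integrable lebesgue (\<lambda>x. exp (- x) ^ n * ?V x)"
      by (rule Km) (use V in \<open>simp add: laplace_exists_one_iff\<close>)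
    have LK: "(\<integral>x. exp (- x) ^ n * ?K x \<partial>lebesgue) = laplace k (real (Suc n)) + c * (1 / real (Suc n))"
    proof -
      have "(\<integral>x. exp (- x) ^ n * ?K x \<partial>lebesgue) = laplace k (real (Suc n)) + c * laplace (\<lambda>x. 1) (real (Suc n))"
        unfolding Kn laplace_as_moment using Km[of k n] Km[of "\<lambda>x. 1" n] k(1)[rule_format, of 1] laplace_one(1)[of 1] by simp
      then show ?thesis by (simp add: laplace_one)
    qed
    have "(\<integral>z. exp (- (fst z + snd z)) ^ n * (exp (- (fst z + snd z)) * \<rho> z) \<partial>(lebesgue \<Otimes>\<^sub>M lebesgue))
       = (\<integral>z. (exp (- fst z) ^ n * ?V (fst z)) * (exp (- snd z) ^ n * ?K (snd z)) \<partial>(lebesgue \<Otimes>\<^sub>M lebesgue))"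
    proof (intro Bochner_Integration.integral_cong refl)
      fix z :: "real \<times> real"
      have "exp (- (fst z + snd z)) ^ n = exp (- fst z) ^ n * exp (- snd z) ^ n"
        by (simp add: power_mult_distrib[symmetric] mult_exp_exp)
      then show "exp (- (fst z + snd z)) ^ n * (exp (- (fst z + snd z)) * \<rho> z)
          = exp (- fst z) ^ n * ?V (fst z) * (exp (- snd z) ^ n * ?K (snd z))"
        unfolding e by (simp only: mult_ac)
    qed
    also have "\<dots> = laplace (\<lambda>x. v x c) (real (Suc n)) * (laplace k (real (Suc n)) + c * (1 / real (Suc n)))"
      unfolding lebesgue_product(2)[OF iV iK] LK laplace_as_moment ..
    also have "\<dots> = 1 / real (Suc n)"
    proof -
      have L: "laplace (\<lambda>t. v t c) (real (Suc n)) = 1 / (real (Suc n) * laplace k (real (Suc n)) + c)"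
        using v c unfolding impulse_response_def by auto
      have "real (Suc n) * laplace k (real (Suc n)) + c > 0"
        using c k(2) by (intro add_nonneg_pos mult_nonneg_nonneg) auto
      then show ?thesis unfolding L by (simp add: divide_simps del: of_nat_Suc)
    qed
    finally show ?thesis .
  qed
  have Ym: "(\<lambda>z::real \<times> real. exp (- (fst z + snd z))) \<in> borel_measurable (lebesgue \<Otimes>\<^sub>M lebesgue)"
    by (rule measurable_compose[OF measurable_sum_lebesgue_pair]) measurable
  have "(\<integral>z. exp (- (fst z + snd z)) ^ n * (1 - exp (- (fst z + snd z))) ^ m * (exp (- (fst z + snd z)) * \<rho> z) \<partial>(lebesgue \<Otimes>\<^sub>M lebesgue))
      = (neg_diff ^^ m) (\<lambda>n. 1 / real (Suc n)) n"
    unfolding mom[symmetric] by (rule neg_diff_moments[OF Ym I, symmetric]) (auto simp: \<rho>_def indicator_def split: if_splits)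
  also have "(\<lambda>n. 1 / real (Suc n)) = (\<lambda>n. \<integral>x. exp (- x) ^ n * (exp (- x) * indicator {0<..} x) \<partial>lebesgue)"
  proof
    fix n
    show "1 / real (Suc n) = (\<integral>x. exp (- x) ^ n * (exp (- x) * indicator {0<..} x) \<partial>lebesgue)"
      using laplace_as_moment[of "\<lambda>x. 1" n] laplace_one(2)[of "real (Suc n)"] by (simp add: mult_ac)
  qed
  also have "(neg_diff ^^ m) \<dots> n = (\<integral>x. exp (- x) ^ n * (1 - exp (- x)) ^ m * (exp (- x) * indicator {0<..} x) \<partial>lebesgue)"
    using laplace_one(1)[of 1]
    by (intro neg_diff_moments[OF measurable_exp_uminus]) (auto simp: laplace_exists_one_iff indicator_def mult_ac split: if_splits)
  finally show "(\<integral>z. exp (- (fst z + snd z)) ^ n * (1 - exp (- (fst z + snd z))) ^ m * (exp (- (fst z + snd z)) * \<rho> z) \<partial>(lebesgue \<Otimes>\<^sub>M lebesgue))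
       = (\<integral>x. exp (- x) ^ n * (1 - exp (- x)) ^ m * (exp (- x) * indicator {0<..} x) \<partial>lebesgue)" .
qed

text \<open>Integrating the equation gives \<open>(k + c) * w = 1 * F\<close>, with \<open>*\<close> the convolution. Convolving
with \<open>v\<close> and using \<open>v * (k + c) = 1\<close> gives \<open>1 * w = v * (1 * F)\<close>, and differentiation at \<open>T\<close> from the left
removes the integrals.\<close>

lemma relaxation_equation_solution:
  fixes w F :: "real \<Rightarrow> real"
  assumes k: "admissible_kernel k" and v: "impulse_response k v" and c: "c > 0" and T: "T > 0"
    and w: "continuous_on {0..T} w" "w 0 = 0" and F: "continuous_on {0..T} F"
    and diff: "\<And>t. t \<in> {0<..<T} \<Longrightarrow> convol k w differentiable (at t)"
    and eq: "\<And>t. t \<in> {0<..<T} \<Longrightarrow> deriv (convol k w) t + c * w t = F t"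
  shows "w T = convol (\<lambda>t. v t c) F T"
proof -
  define a where "a x = v x c" for x
  define I where "I t = integral {0..t} F" for t
  define W where "W t = integral {0..t} w" for t
  have kex: "\<forall>s>0. laplace_exists k s" and k0: "\<And>t. t > 0 \<Longrightarrow> k t \<ge> 0"
    using k unfolding admissible_kernel_def by auto
  have kl: "laplace k s \<ge> 0" for s by (rule laplace_nonneg) (rule k0)
  have kint: "integrable lebesgue (\<lambda>x. indicator {0<..} x * (exp (- x) * k x))"
    using kex[rule_format, of 1] by (simp add: laplace_exists_one_iff)
  have aint: "integrable lebesgue (\<lambda>x. indicator {0<..} x * (exp (- x) * a x))"
    using v c laplace_exists_one_iff[of a] unfolding impulse_response_def a_def by auto
  have volterra: "(\<integral>y. indicator {0<..<t} y * (k y + c) * w (t - y) \<partial>lebesgue) = I t" if t: "0 \<le> t" "t \<le> T" for t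
  proof -
    have sub: "continuous_on {0..t} w" "continuous_on {0..t} F" "continuous_on {0..t} (convol k w)"
      using continuous_on_subset[OF w(1)] continuous_on_subset[OF F]
        continuous_on_subset[OF continuous_on_convol[OF kint w]] t by auto
    have "((\<lambda>r. F r - c * w r) has_integral (convol k w t - convol k w 0)) {0..t}"
    proof (rule fundamental_theorem_of_calculus_interior[OF t(1) sub(3)])
      fix r assume "r \<in> {0<..<t}"
      then have r: "r \<in> {0<..<T}" using t by auto
      have "(convol k w has_real_derivative deriv (convol k w) r) (at r)"
        using diff[OF r] by (simp add: DERIV_deriv_iff_real_differentiable)
      then show "(convol k w has_vector_derivative F r - c * w r) (at r)"
        using eq[OF r] by (simp add: has_real_derivative_iff_has_vector_derivative[symmetric] eq_diff_eq[symmetric])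
    qed
    moreover have "((\<lambda>r. F r - c * w r) has_integral (I t - c * W t)) {0..t}"
      unfolding I_def W_def using sub
      by (intro has_integral_diff has_integral_mult_right integrable_integral integrable_continuous_real)
    moreover have "convol k w 0 = 0" using convol_eq[OF kint w(1), of 0] T by simp
    ultimately have "convol k w t = I t - c * W t" by (simp add: has_integral_unique)
    moreover have "convol k w t = (\<integral>y. indicator {0<..<t} y * k y * w (t - y) \<partial>lebesgue)"
      by (rule convol_eq[OF kint w(1) t])
    moreover have "W t = (\<integral>y. indicator {0<..<t} y * w (t - y) \<partial>lebesgue)"
      unfolding W_def by (rule convol_one[OF w(1) t, symmetric])
    moreover have one: "integrable lebesgue (\<lambda>y. indicator {0<..<t} y * w (t - y))"
    proof -
      have "integrable lebesgue (\<lambda>x::real. indicator {0<..} x * (exp (- x) * 1) :: real)"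
        using laplace_one(1)[of 1] by (simp add: laplace_exists_one_iff)
      from integrable_truncated_convol[OF this w(1) t] show ?thesis by simp
    qed
    moreover have "(\<integral>y. indicator {0<..<t} y * (k y + c) * w (t - y) \<partial>lebesgue)
       = (\<integral>y. indicator {0<..<t} y * k y * w (t - y) + c * (indicator {0<..<t} y * w (t - y)) \<partial>lebesgue)"
      by (intro Bochner_Integration.integral_cong refl) (simp add: algebra_simps)
    ultimately show ?thesis
      using integrable_truncated_convol[OF kint w(1) t] by simp
  qed
  have duality: "(\<integral>x. indicator {0<..<t} x * a x * I (t - x) \<partial>lebesgue) = W t" if t: "0 < t" "t \<le> T" for t
  proof -
    have wt: "continuous_on {0..t} (\<lambda>z. w (t - z))"
      by (rule continuous_on_compose2[OF w(1)]) (use t in \<open>auto intro!: continuous_intros\<close>)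
    let ?M = "lebesgue \<Otimes>\<^sub>M lebesgue :: (real \<times> real) measure"
    let ?Z = "\<lambda>z::real \<times> real. fst z + snd z"
    define \<rho> where "\<rho> z = indicator {0<..} (fst z) * a (fst z) * (indicator {0<..} (snd z) * (k (snd z) + c))" for z
    have res: "integrable ?M (\<lambda>z. exp (- ?Z z) * \<rho> z)"
      "(\<integral>z. exp (- ?Z z) ^ n * (1 - exp (- ?Z z)) ^ m * (exp (- ?Z z) * \<rho> z) \<partial>?M)
       = (\<integral>x. exp (- x) ^ n * (1 - exp (- x)) ^ m * (exp (- x) * indicator {0<..} x) \<partial>lebesgue)" for n m
      unfolding \<rho>_def a_def by (rule impulse_resolvent_moments[OF v c kex kl])+
    note idm = measurable_ident_lebesgue
    note Zm = measurable_sum_lebesgue_pair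
    have one: "integrable lebesgue (\<lambda>x::real. exp (- x) * indicator {0<..} x :: real)"
      using laplace_one(1)[of 1] by (simp add: laplace_exists_one_iff mult.commute)
    have \<rho>0: "\<rho> z \<noteq> 0 \<Longrightarrow> 0 \<le> ?Z z" for z by (auto simp: \<rho>_def indicator_def split: if_splits)
    have int: "integrable ?M (\<lambda>z. indicator {..<t} (?Z z) * w (t - ?Z z) * \<rho> z)"
      by (rule cutoff_tendsto(2)[where p = "\<lambda>z. w (t - z)", OF Zm res(1) _ t(1) wt]) (rule \<rho>0)
    \<comment> \<open>for fixed \<open>x\<close> the inner integral is the convolution of \<open>k + c\<close> with \<open>w\<close> at \<open>t - x\<close>\<close>
    have inner: "(\<integral>y. indicator {..<t} (x + y) * w (t - (x + y)) * \<rho> (x, y) \<partial>lebesgue)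
        = indicator {0<..<t} x * a x * I (t - x)" for x
    proof (cases "x \<in> {0<..<t}")
      case True
      have "(\<integral>y. indicator {..<t} (x + y) * w (t - (x + y)) * \<rho> (x, y) \<partial>lebesgue)
          = (\<integral>y. a x * (indicator {0<..<t - x} y * (k y + c) * w ((t - x) - y)) \<partial>lebesgue)"
        using True by (intro Bochner_Integration.integral_cong refl) (auto simp: \<rho>_def indicator_def algebra_simps)
      also have "\<dots> = a x * I (t - x)"
        using volterra[of "t - x"] True t by simp
      finally show ?thesis using True by simp
    next
      case False
      then have "(\<lambda>y. indicator {..<t} (x + y) * w (t - (x + y)) * \<rho> (x, y)) = (\<lambda>y. 0)"
        by (auto simp: \<rho>_def indicator_def)
      then show ?thesis using False by (simp only:) simp
    qed
    have "(\<integral>x. indicator {0<..<t} x * a x * I (t - x) \<partial>lebesgue) = (\<integral>z. indicator {..<t} (?Z z) * w (t - ?Z z) * \<rho> z \<partial>?M)"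
      using lebesgue_pair.integral_fst'[OF int] by (simp add: inner)
    also have "\<dots> = (\<integral>z. indicator {..<t} z * w (t - z) * indicator {0<..} z \<partial>lebesgue)"
      by (rule moment_equality_halfline[where p = "\<lambda>z. w (t - z)", OF Zm res(1) _ idm one _ res(2) t(1) wt])
         (use \<rho>0 in \<open>auto simp: indicator_def split: if_splits\<close>)
    also have "\<dots> = (\<integral>x. indicator {0<..<t} x * w (t - x) \<partial>lebesgue)"
      by (intro Bochner_Integration.integral_cong refl) (auto simp: indicator_def)
    also have "\<dots> = W t" unfolding W_def using t by (intro convol_one[OF w(1)]) auto
    finally show ?thesis .
  qed
  have I0: "I 0 = 0" "W 0 = 0" by (simp_all add: I_def W_def)
  have dI: "(I has_real_derivative F t) (at t within {0..T})" and dW: "(W has_real_derivative w t) (at t within {0..T})"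
    if "t \<in> {0..T}" for t
    unfolding I_def W_def using that by (intro integral_has_real_derivative F w(1); simp)+
  obtain C where C: "C \<ge> 0" "\<And>t. t \<in> {0..T} \<Longrightarrow> \<bar>F t\<bar> \<le> C"
    using const_ext_bounded[of T F] F T by (metis atLeastAtMost_iff const_ext_eq less_imp_le)
  have lip: "\<bar>I (max 0 x) - I (max 0 y)\<bar> \<le> C * \<bar>x - y\<bar>" if "x \<le> T" "y \<le> T" for x y
  proof -
    have "norm (I (max 0 x) - I (max 0 y)) \<le> C * norm (max 0 x - max 0 y)"
      by (rule field_differentiable_bound[where S = "{0..T}" and f' = F]) (use dI C that T in auto)
    also have "\<dots> \<le> C * \<bar>x - y\<bar>" using C(1) by (intro mult_left_mono) auto
    finally show ?thesis by simp
  qed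
  \<comment> \<open>a null sequence in the open interval \<open>(0, T)\<close>\<close>
  define h where "h j = T / (real j + 2)" for j :: nat
  have h: "h j > 0" "h j < T" for j using T by (auto simp: h_def divide_less_eq)
  have h0: "h \<longlonglongrightarrow> 0" unfolding h_def by real_asymp
  let ?G = "\<lambda>t x. indicator {0<..<T} x * a x * I (max 0 (t - x))"
  have Gint: "integrable lebesgue (?G t)" and Geq: "(\<integral>x. ?G t x \<partial>lebesgue) = W t" if t: "0 < t" "t \<le> T" for t
  proof -
    have cI: "continuous_on {0..T} I"
      using dI by (meson DERIV_continuous_on)
    have eqG: "?G t x = indicator {0<..<t} x * a x * I (t - x)" for x
      using t I0 by (auto simp: indicator_def max_def)
    show "integrable lebesgue (?G t)"
      unfolding eqG using t by (intro integrable_truncated_convol[OF aint cI]) auto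
    show "(\<integral>x. ?G t x \<partial>lebesgue) = W t"
      unfolding eqG by (rule duality[OF t])
  qed
  have quot: "(W T - W (T - h j)) / h j = (\<integral>x. (?G T x - ?G (T - h j) x) / h j \<partial>lebesgue)" for j
    using Gint[of T] Gint[of "T - h j"] Geq[of T] Geq[of "T - h j"] h[of j] T by simp
  have Fr: "continuous_on {0..T} (\<lambda>x. F (T - x))"
    by (rule continuous_on_compose2[OF F]) (auto intro!: continuous_intros)
  have aI: "integrable lebesgue (\<lambda>x. indicator {0<..<T} x * a x * 1)"
    using T by (intro integrable_truncated_continuous[OF aint]) auto
  have "(\<lambda>j. (W T - W (T - h j)) / h j) \<longlonglongrightarrow> (\<integral>x. indicator {0<..<T} x * a x * F (T - x) \<partial>lebesgue)"
    unfolding quot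
  proof (rule integral_dominated_convergence[where w = "\<lambda>x. C * \<bar>indicator {0<..<T} x * a x * 1\<bar>"])
    show "integrable lebesgue (\<lambda>x. C * \<bar>indicator {0<..<T} x * a x * 1\<bar>)"
      using aI by (intro integrable_mult_right integrable_abs)
    show "(\<lambda>x. indicator {0<..<T} x * a x * F (T - x)) \<in> borel_measurable lebesgue"
      using integrable_truncated_convol[OF aint F, of T] T by auto
    show "(\<lambda>x. (?G T x - ?G (T - h j) x) / h j) \<in> borel_measurable lebesgue" for j
      using Gint[of T] Gint[of "T - h j"] h[of j] T by (intro borel_measurable_divide borel_measurable_diff) auto
    show "AE x in lebesgue. (\<lambda>j. (?G T x - ?G (T - h j) x) / h j) \<longlonglongrightarrow> indicator {0<..<T} x * a x * F (T - x)"
    proof (rule AE_I2)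
      fix x :: real
      show "(\<lambda>j. (?G T x - ?G (T - h j) x) / h j) \<longlonglongrightarrow> indicator {0<..<T} x * a x * F (T - x)"
      proof (cases "x \<in> {0<..<T}")
        case True
        then have r: "T - x \<in> {0<..<T}" by auto
        have "eventually (\<lambda>j. h j < T - x) sequentially"
          using order_tendstoD(2)[OF h0] r by simp
        then have ev: "eventually (\<lambda>j. T - x - h j \<in> {0..T} \<and> h j \<noteq> 0) sequentially"
        proof eventually_elim
          case (elim j)
          then show ?case using h(1)[of j] r by auto
        qed
        then have "(\<lambda>j. (I (T - x) - I (T - x - h j)) / h j) \<longlonglongrightarrow> F (T - x)"
          by (intro tendsto_difference_quotient[OF dI h0]) (use r in \<open>auto elim: eventually_mono\<close>)
        then have "(\<lambda>j. a x * ((I (T - x) - I (T - x - h j)) / h j)) \<longlonglongrightarrow> a x * F (T - x)"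
          by (intro tendsto_mult_left)
        then have "(\<lambda>j. (?G T x - ?G (T - h j) x) / h j) \<longlonglongrightarrow> a x * F (T - x)"
          by (rule Lim_transform_eventually)
             (rule eventually_mono[OF ev], use True in \<open>auto simp: max_absorb2 algebra_simps diff_divide_distrib\<close>)
        then show ?thesis using True by simp
      qed auto
    qed
    show "AE x in lebesgue. norm ((?G T x - ?G (T - h j) x) / h j) \<le> C * \<bar>indicator {0<..<T} x * a x * 1\<bar>" for j
    proof (rule AE_I2)
      fix x :: real
      have "\<bar>?G T x - ?G (T - h j) x\<bar> = \<bar>indicator {0<..<T} x * a x\<bar> * \<bar>I (max 0 (T - x)) - I (max 0 (T - h j - x))\<bar>"
        by (simp add: abs_mult[symmetric] right_diff_distrib)
      also have "\<dots> \<le> \<bar>indicator {0<..<T} x * a x\<bar> * (C * h j)"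
      proof (cases "x > 0")
        case True
        then show ?thesis using lip[of "T - x" "T - h j - x"] h[of j] by (intro mult_left_mono) auto
      qed auto
      finally show "norm ((?G T x - ?G (T - h j) x) / h j) \<le> C * \<bar>indicator {0<..<T} x * a x * 1\<bar>"
        using h[of j] by (simp add: abs_divide divide_le_eq mult_ac del: abs_mult)
    qed
  qed
  moreover have "(\<lambda>j. (W T - W (T - h j)) / h j) \<longlonglongrightarrow> w T"
  proof (intro tendsto_difference_quotient[OF dW h0] always_eventually allI conjI)
    fix j
    show "h j \<noteq> 0" using h(1)[of j] by simp
    show "T - h j \<in> {0..T}" using h(1)[of j] h(2)[of j] by simp
  qed (use T in simp)
  ultimately have "w T = (\<integral>x. indicator {0<..<T} x * a x * F (T - x) \<partial>lebesgue)"
    using LIMSEQ_unique by blast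
  then show ?thesis using convol_eq[OF aint F, of T] T by (simp add: a_def)
qed
section \<open>The space of square integrable functions\<close>

lemma L2_mult_integrable:
  assumes "f \<in> L2 \<Omega>" "g \<in> L2 \<Omega>"
  shows "integrable (lebesgue_on \<Omega>) (\<lambda>x. f x * g x)"
proof (rule Bochner_Integration.integrable_bound)
  show "integrable (lebesgue_on \<Omega>) (\<lambda>x. (f x)\<^sup>2 + (g x)\<^sup>2)"
    using assms by (auto simp: L2_def)
  have "\<bar>a * b\<bar> \<le> a\<^sup>2 + b\<^sup>2" for a b :: real
  proof -
    have "2 * (\<bar>a\<bar> * \<bar>b\<bar>) \<le> a\<^sup>2 + b\<^sup>2"
      using sum_squares_bound[of "\<bar>a\<bar>" "\<bar>b\<bar>"] by (simp add: mult.assoc)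
    moreover have "0 \<le> \<bar>a\<bar> * \<bar>b\<bar>" by simp
    ultimately show ?thesis unfolding abs_mult by linarith
  qed
  then show "AE x in lebesgue_on \<Omega>. norm (f x * g x) \<le> norm ((f x)\<^sup>2 + (g x)\<^sup>2)"
    by (intro AE_I2) simp
qed (use assms in \<open>auto simp: L2_def\<close>)

lemma L2_add: "f \<in> L2 \<Omega> \<Longrightarrow> g \<in> L2 \<Omega> \<Longrightarrow> (\<lambda>x. f x + g x) \<in> L2 \<Omega>"
  using L2_mult_integrable[of f \<Omega> g] by (auto simp: L2_def power2_sum mult.assoc)

lemma L2_scale: "f \<in> L2 \<Omega> \<Longrightarrow> (\<lambda>x. c * f x) \<in> L2 \<Omega>"
  by (auto simp: L2_def power_mult_distrib)

lemma L2_diff: "f \<in> L2 \<Omega> \<Longrightarrow> g \<in> L2 \<Omega> \<Longrightarrow> (\<lambda>x. f x - g x) \<in> L2 \<Omega>"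
  using L2_add[OF _ L2_scale[of g \<Omega> "- 1"], of f] by simp

lemma L2_zero: "(\<lambda>x. 0) \<in> L2 \<Omega>"
  by (simp add: L2_def)

lemma L2_sum: "(\<And>i. i \<in> A \<Longrightarrow> f i \<in> L2 \<Omega>) \<Longrightarrow> (\<lambda>x. \<Sum>i\<in>A. f i x) \<in> L2 \<Omega>"
  by (induction A rule: infinite_finite_induct) (auto intro: L2_zero L2_add)

lemma L2_inner_commute: "L2_inner \<Omega> f g = L2_inner \<Omega> g f"
  by (simp add: L2_inner_def mult.commute)

lemma L2_inner_add:
  "f \<in> L2 \<Omega> \<Longrightarrow> g \<in> L2 \<Omega> \<Longrightarrow> h \<in> L2 \<Omega> \<Longrightarrow>
     L2_inner \<Omega> (\<lambda>x. f x + g x) h = L2_inner \<Omega> f h + L2_inner \<Omega> g h"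
  using L2_mult_integrable[of f \<Omega> h] L2_mult_integrable[of g \<Omega> h] by (simp add: L2_inner_def distrib_right)

lemma L2_inner_scale: "L2_inner \<Omega> (\<lambda>x. c * f x) h = c * L2_inner \<Omega> f h"
  by (simp add: L2_inner_def mult.assoc)

lemma L2_inner_diff:
  "f \<in> L2 \<Omega> \<Longrightarrow> g \<in> L2 \<Omega> \<Longrightarrow> h \<in> L2 \<Omega> \<Longrightarrow>
     L2_inner \<Omega> (\<lambda>x. f x - g x) h = L2_inner \<Omega> f h - L2_inner \<Omega> g h"
  using L2_mult_integrable[of f \<Omega> h] L2_mult_integrable[of g \<Omega> h] by (simp add: L2_inner_def left_diff_distrib)

lemma L2_inner_add_right:
  "f \<in> L2 \<Omega> \<Longrightarrow> g \<in> L2 \<Omega> \<Longrightarrow> h \<in> L2 \<Omega> \<Longrightarrow>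
     L2_inner \<Omega> h (\<lambda>x. f x + g x) = L2_inner \<Omega> h f + L2_inner \<Omega> h g"
  by (simp only: L2_inner_commute[of \<Omega> h] L2_inner_add)

lemma L2_inner_scale_right: "L2_inner \<Omega> h (\<lambda>x. c * f x) = c * L2_inner \<Omega> h f"
  by (simp only: L2_inner_commute[of \<Omega> h] L2_inner_scale)

lemma L2_inner_diff_right:
  "f \<in> L2 \<Omega> \<Longrightarrow> g \<in> L2 \<Omega> \<Longrightarrow> h \<in> L2 \<Omega> \<Longrightarrow>
     L2_inner \<Omega> h (\<lambda>x. f x - g x) = L2_inner \<Omega> h f - L2_inner \<Omega> h g"
  by (simp only: L2_inner_commute[of \<Omega> h] L2_inner_diff)

lemma L2_inner_sum:
  assumes "\<And>i. i \<in> A \<Longrightarrow> f i \<in> L2 \<Omega>" "h \<in> L2 \<Omega>"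
  shows "L2_inner \<Omega> (\<lambda>x. \<Sum>i\<in>A. f i x) h = (\<Sum>i\<in>A. L2_inner \<Omega> (f i) h)"
  using assms(1)
proof (induction A rule: infinite_finite_induct)
  case (insert i A)
  then show ?case using assms(2) by (simp add: L2_inner_add L2_sum)
qed (auto simp: L2_inner_def)

lemma L2_inner_cong_AE:
  assumes "f \<in> L2 \<Omega>" "g \<in> L2 \<Omega>" "h \<in> L2 \<Omega>" "AE x in lebesgue_on \<Omega>. f x = g x"
  shows "L2_inner \<Omega> f h = L2_inner \<Omega> g h"
  unfolding L2_inner_def
  using assms by (intro integral_cong_AE) (auto simp: L2_def)

lemma L2_inner_self_nonneg: "0 \<le> L2_inner \<Omega> f f"
  unfolding L2_inner_def by (intro Bochner_Integration.integral_nonneg) auto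

lemma L2_norm_nonneg: "0 \<le> L2_norm \<Omega> f"
  by (simp add: L2_norm_def L2_inner_self_nonneg)

lemma L2_norm_sq: "(L2_norm \<Omega> f)\<^sup>2 = L2_inner \<Omega> f f"
  by (simp add: L2_norm_def L2_inner_self_nonneg)

lemma L2_Cauchy_Schwarz:
  assumes f: "f \<in> L2 \<Omega>" and g: "g \<in> L2 \<Omega>"
  shows "\<bar>L2_inner \<Omega> f g\<bar> \<le> L2_norm \<Omega> f * L2_norm \<Omega> g"
proof -
  define A B C where "A = L2_inner \<Omega> f f" and "B = L2_inner \<Omega> f g" and "C = L2_inner \<Omega> g g"
  have quad: "0 \<le> A - 2 * t * B + t\<^sup>2 * C" for t
  proof -
    have "L2_inner \<Omega> (\<lambda>x. f x - t * g x) (\<lambda>x. f x - t * g x) = A - 2 * t * B + t\<^sup>2 * C"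
      using f g L2_scale[OF g, of t] L2_diff[OF f L2_scale[OF g, of t]]
      by (simp add: L2_inner_diff L2_inner_scale L2_inner_diff_right L2_inner_scale_right
          A_def B_def C_def L2_inner_commute[of \<Omega> g f] power2_eq_square right_diff_distrib)
    then show ?thesis using L2_inner_self_nonneg by metis
  qed
  have "B\<^sup>2 \<le> A * C"
  proof (cases "C = 0")
    case True
    have "B = 0"
    proof (rule ccontr)
      assume "B \<noteq> 0"
      then show False using quad[of "(A + 1) / (2 * B)"] True by simp
    qed
    then show ?thesis using True by simp
  next
    case False
    then have "C > 0" using L2_inner_self_nonneg[of \<Omega> g] by (simp add: C_def)
    then show ?thesis using quad[of "B / C"] by (simp add: power2_eq_square field_simps)
  qed
  then have "sqrt (B\<^sup>2) \<le> sqrt (A * C)" by (rule real_sqrt_le_mono)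
  then show ?thesis by (simp add: L2_norm_def A_def B_def C_def real_sqrt_mult)
qed

lemma L2_norm_triangle:
  assumes f: "f \<in> L2 \<Omega>" and g: "g \<in> L2 \<Omega>"
  shows "L2_norm \<Omega> (\<lambda>x. f x + g x) \<le> L2_norm \<Omega> f + L2_norm \<Omega> g"
proof (rule power2_le_imp_le)
  have "(L2_norm \<Omega> (\<lambda>x. f x + g x))\<^sup>2 = (L2_norm \<Omega> f)\<^sup>2 + 2 * L2_inner \<Omega> f g + (L2_norm \<Omega> g)\<^sup>2"
    using f g L2_add[OF f g]
    by (simp add: L2_norm_sq L2_inner_add L2_inner_add_right L2_inner_commute[of \<Omega> g f])
  also have "\<dots> \<le> (L2_norm \<Omega> f)\<^sup>2 + 2 * (L2_norm \<Omega> f * L2_norm \<Omega> g) + (L2_norm \<Omega> g)\<^sup>2"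
    using L2_Cauchy_Schwarz[OF f g] by simp
  finally show "(L2_norm \<Omega> (\<lambda>x. f x + g x))\<^sup>2 \<le> (L2_norm \<Omega> f + L2_norm \<Omega> g)\<^sup>2"
    by (simp add: power2_sum)
qed (simp add: L2_norm_nonneg)

lemma L2_norm_sum:
  assumes "\<And>i. i \<in> A \<Longrightarrow> f i \<in> L2 \<Omega>"
  shows "L2_norm \<Omega> (\<lambda>x. \<Sum>i\<in>A. f i x) \<le> (\<Sum>i\<in>A. L2_norm \<Omega> (f i))"
  using assms
proof (induction A rule: infinite_finite_induct)
  case (insert i A)
  then have "L2_norm \<Omega> (\<lambda>x. f i x + (\<Sum>i\<in>A. f i x)) \<le> L2_norm \<Omega> (f i) + L2_norm \<Omega> (\<lambda>x. \<Sum>i\<in>A. f i x)"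
    by (intro L2_norm_triangle L2_sum) auto
  then show ?case using insert by force
qed (auto simp: L2_norm_def L2_inner_def)

section \<open>Test functions and integration by parts\<close>

lemma partials_single: "partials [b] f = (\<lambda>x. frechet_derivative f (at x) b)"
  by (simp add: partials_def)

lemma partials_append: "partials (bs @ [b]) f = partials bs (partials [b] f)"
  by (simp add: partials_def)

lemma test_functionsD:
  assumes "\<psi> \<in> test_functions \<Omega>" "set bs \<subseteq> Basis"
  shows "partials bs \<psi> differentiable (at x)" "continuous_on UNIV (partials bs \<psi>)"
  using assms unfolding test_functions_def Ck_on_def by (force dest: spec[of _ "Suc (length bs)"])+

lemma test_function_smooth:
  assumes "\<psi> \<in> test_functions \<Omega>"
  shows "\<psi> differentiable (at x)" "continuous_on UNIV \<psi>"
  using test_functionsD[OF assms, of "[]"] by (auto simp: partials_def)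

lemma test_function_support:
  assumes "\<psi> \<in> test_functions \<Omega>"
  shows "compact (closure {x. \<psi> x \<noteq> 0})" "closure {x. \<psi> x \<noteq> 0} \<subseteq> \<Omega>"
  using assms by (auto simp: test_functions_def)

lemma not_in_support: "x \<notin> closure {x. f x \<noteq> (0::real)} \<Longrightarrow> f x = 0"
  using closure_subset[of "{x. f x \<noteq> 0}"] by blast

lemma partial_vanishes:
  fixes \<psi> :: "'a::euclidean_space \<Rightarrow> real"
  assumes x: "x \<notin> closure {x. \<psi> x \<noteq> 0}"
  shows "partials [b] \<psi> x = 0"
proof -
  have "(\<psi> has_derivative (\<lambda>x. 0)) (at x)"
  proof (rule has_derivative_transform_within_open[where s = "- closure {x. \<psi> x \<noteq> 0}" and f = "\<lambda>x. 0"])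
    show "0 = \<psi> y" if "y \<in> - closure {x. \<psi> x \<noteq> 0}" for y
      using that closure_subset[of "{x. \<psi> x \<noteq> 0}"] by auto
  qed (use x in auto)
  then have "frechet_derivative \<psi> (at x) = (\<lambda>x. 0)" by (rule frechet_derivative_at[symmetric])
  then show ?thesis by (simp add: partials_single)
qed

lemma test_function_partial:
  assumes \<psi>: "\<psi> \<in> test_functions \<Omega>" and b: "b \<in> Basis"
  shows "partials [b] \<psi> \<in> test_functions \<Omega>"
proof -
  let ?K = "closure {x. \<psi> x \<noteq> 0}"
  have "Ck_on m UNIV (partials [b] \<psi>)" for m
    unfolding Ck_on_def partials_append[symmetric]
    using test_functionsD[OF \<psi>, of "_ @ [b]"] b by auto
  moreover have "closure {x. partials [b] \<psi> x \<noteq> 0} \<subseteq> ?K"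
    using partial_vanishes by (intro closure_minimal) blast+
  moreover have "compact ?K" "?K \<subseteq> \<Omega>" using \<psi> by (auto simp: test_functions_def)
  moreover from calculation have "compact (closure {x. partials [b] \<psi> x \<noteq> 0})"
    by (metis closed_closure compact_Int_closed inf.absorb_iff2)
  ultimately show ?thesis by (auto simp: test_functions_def)
qed

lemma integrable_compact_support:
  fixes f :: "'a::euclidean_space \<Rightarrow> real"
  assumes "continuous_on UNIV f" "compact K" "\<And>x. x \<notin> K \<Longrightarrow> f x = 0"
  shows "integrable lborel f"
proof -
  have "integrable lborel (\<lambda>x. indicator K x *\<^sub>R f x)"
    using assms by (intro borel_integrable_compact) (auto intro: continuous_on_subset)
  moreover have "(\<lambda>x. indicator K x *\<^sub>R f x) = f" using assms(3) by (auto simp: indicator_def fun_eq_iff)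
  ultimately show ?thesis by simp
qed

lemma integral_compact_support:
  fixes f :: "'a::euclidean_space \<Rightarrow> real"
  assumes \<Omega>: "open \<Omega>" and f: "continuous_on UNIV f" "compact K" "K \<subseteq> \<Omega>" "\<And>x. x \<notin> K \<Longrightarrow> f x = 0"
  shows "integrable (lebesgue_on \<Omega>) f" "(\<integral>x. f x \<partial>lebesgue_on \<Omega>) = (\<integral>x. f x \<partial>lborel)"
proof -
  have I: "integrable lborel f" using integrable_compact_support f by blast
  have ind: "(\<lambda>x. indicator \<Omega> x *\<^sub>R f x) = f" using f(3,4) by (auto simp: indicator_def fun_eq_iff)
  have m: "\<Omega> \<inter> space lebesgue \<in> sets lebesgue" using \<Omega> by auto
  have Il: "integrable lebesgue f"
    using I by (simp add: integrable_completion borel_measurable_integrable)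
  show "integrable (lebesgue_on \<Omega>) f"
    unfolding integrable_restrict_space[OF m] ind by (rule Il)
  show "(\<integral>x. f x \<partial>lebesgue_on \<Omega>) = (\<integral>x. f x \<partial>lborel)"
    unfolding integral_restrict_space[OF m] ind
    using I by (simp add: integral_completion borel_measurable_integrable)
qed

lemma test_function_L2:
  assumes \<Omega>: "open \<Omega>" and \<psi>: "\<psi> \<in> test_functions \<Omega>"
  shows "\<psi> \<in> L2 \<Omega>"
proof -
  note K = test_function_support[OF \<psi>]
  note c = test_function_smooth(2)[OF \<psi>]
  have c2: "continuous_on UNIV (\<lambda>x. (\<psi> x)\<^sup>2)" using c by (intro continuous_intros)
  have "(\<psi> x)\<^sup>2 = 0" if "x \<notin> closure {x. \<psi> x \<noteq> 0}" for x
    using not_in_support[OF that] by simp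
  then have "integrable (lebesgue_on \<Omega>) (\<lambda>x. (\<psi> x)\<^sup>2)"
    by (rule integral_compact_support(1)[OF \<Omega> c2 K])
  moreover have "integrable (lebesgue_on \<Omega>) \<psi>"
    by (rule integral_compact_support(1)[OF \<Omega> c K not_in_support[of _ \<psi>]])
  ultimately show ?thesis by (auto simp: L2_def)
qed

lemma line_derivative:
  fixes p :: "'a::euclidean_space \<Rightarrow> real"
  assumes "\<And>x. p differentiable (at x)"
  shows "((\<lambda>t. p (x + t *\<^sub>R b)) has_real_derivative frechet_derivative p (at (x + t *\<^sub>R b)) b) (at t)"
proof -
  have "(p has_derivative frechet_derivative p (at (x + t *\<^sub>R b))) (at (x + t *\<^sub>R b))"
    using assms frechet_derivative_works by blast
  moreover have "((\<lambda>t. x + t *\<^sub>R b) has_derivative (\<lambda>s. s *\<^sub>R b)) (at t)"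
    by (auto intro!: derivative_eq_intros)
  ultimately have "((\<lambda>t. p (x + t *\<^sub>R b)) has_derivative (\<lambda>s. frechet_derivative p (at (x + t *\<^sub>R b)) (s *\<^sub>R b))) (at t)"
    by (rule has_derivative_compose[rotated, where f = "\<lambda>t. x + t *\<^sub>R b" and g = p, unfolded comp_def])
  moreover have "linear (frechet_derivative p (at (x + t *\<^sub>R b)))"
    using assms linear_frechet_derivative by blast
  ultimately show ?thesis
    by (simp add: has_field_derivative_def linear_scale mult_commute_abs mult.commute)
qed

text \<open>The integral of \<open>p\<close> does not change under translation, so the integrals of the difference quotients in
direction \<open>b\<close> vanish.\<close>

lemma integral_partial_zero:
  fixes p :: "'a::euclidean_space \<Rightarrow> real"
  assumes diff: "\<And>x. p differentiable (at x)" and b: "b \<in> Basis"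
    and cont: "continuous_on UNIV (\<lambda>x. frechet_derivative p (at x) b)"
    and K: "compact K" "\<And>x. x \<notin> K \<Longrightarrow> p x = 0"
  shows "(\<integral>x. frechet_derivative p (at x) b \<partial>lborel) = 0"
proof -
  let ?D = "\<lambda>x. frechet_derivative p (at x) b"
  have pc: "continuous_on UNIV p"
    using diff differentiable_imp_continuous_within by (metis continuous_on_eq_continuous_within)
  have pI: "integrable lborel p" using integrable_compact_support[OF pc K] .
  obtain R where R: "\<And>x. x \<in> K \<Longrightarrow> norm x \<le> R" using compact_imp_bounded[OF K(1)] bounded_iff by blast
  have nb: "norm b = 1" using b by simp
  obtain M where M: "\<And>x. norm x \<le> R + 2 \<Longrightarrow> \<bar>?D x\<bar> \<le> M"
    using compact_continuous_image[OF continuous_on_subset[OF cont], of "cball 0 (R + 2)"]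
    by (force simp: bounded_iff dest!: compact_imp_bounded)
  define h where "h j = 1 / real (Suc j)" for j
  have h: "h j > 0" "h j \<le> 1" for j by (auto simp: h_def divide_le_eq)
  have h0: "h \<longlonglongrightarrow> 0" unfolding h_def by (rule lim_1_over_n[THEN LIMSEQ_Suc])
  define q where "q j x = (p (x + h j *\<^sub>R b) - p x) / h j" for j x
  have shift: "integrable lborel (\<lambda>x. p (x + c))" "(\<integral>x. p (x + c) \<partial>lborel) = (\<integral>x. p x \<partial>lborel)" for c
  proof -
    have m: "(+) c \<in> lborel \<rightarrow>\<^sub>M (borel :: 'a measure)" by simp
    have e: "distr lborel borel ((+) c) = (lborel :: 'a measure)" by (rule lborel_distr_plus)
    show "integrable lborel (\<lambda>x. p (x + c))"
      using integrable_distr[OF m, of p] pI e by (simp add: add.commute)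
    show "(\<integral>x. p (x + c) \<partial>lborel) = (\<integral>x. p x \<partial>lborel)"
      using integral_distr[OF m, of p] borel_measurable_integrable[OF pI] e by (simp add: add.commute)
  qed
  have q0: "(\<integral>x. q j x \<partial>lborel) = 0" for j
    unfolding q_def using shift pI by simp
  have qI: "integrable lborel (q j)" for j
    unfolding q_def using shift pI by simp
  have "(\<lambda>j. \<integral>x. q j x \<partial>lborel) \<longlonglongrightarrow> (\<integral>x. ?D x \<partial>lborel)"
  proof (rule integral_dominated_convergence[where w = "\<lambda>x. indicator (cball 0 (R + 1)) x *\<^sub>R M"])
    show "integrable lborel (\<lambda>x::'a. indicator (cball 0 (R + 1)) x *\<^sub>R M)"
      by (rule borel_integrable_compact) auto
    show "?D \<in> borel_measurable lborel" using borel_measurable_continuous_onI[OF cont] by simp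
    show "q j \<in> borel_measurable lborel" for j using qI by auto
    show "AE x in lborel. (\<lambda>j. q j x) \<longlonglongrightarrow> ?D x"
    proof (rule AE_I2)
      fix x
      have "(\<lambda>j. (p (x + 0 *\<^sub>R b) - p (x + (0 - (- h j)) *\<^sub>R b)) / (- h j)) \<longlonglongrightarrow> frechet_derivative p (at (x + 0 *\<^sub>R b)) b"
        by (rule tendsto_difference_quotient[OF line_derivative[OF diff]])
           (use h h0 tendsto_minus[OF h0] in \<open>auto simp: less_imp_neq[symmetric]\<close>)
      then show "(\<lambda>j. q j x) \<longlonglongrightarrow> ?D x"
        by (simp add: q_def minus_divide_left[symmetric] minus_divide_right[symmetric] diff_divide_distrib)
    qed
    show "AE x in lborel. norm (q j x) \<le> indicator (cball 0 (R + 1)) x *\<^sub>R M" for j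
    proof (rule AE_I2)
      fix x
      show "norm (q j x) \<le> indicator (cball 0 (R + 1)) x *\<^sub>R M"
      proof (cases "norm x \<le> R + 1")
        case True
        obtain z where z: "0 < z" "z < h j" "p (x + h j *\<^sub>R b) - p (x + 0 *\<^sub>R b) = (h j - 0) * ?D (x + z *\<^sub>R b)"
          using MVT2[of 0 "h j" "\<lambda>t. p (x + t *\<^sub>R b)" "\<lambda>t. ?D (x + t *\<^sub>R b)"] h[of j] line_derivative[OF diff] by blast
        have "norm (x + z *\<^sub>R b) \<le> R + 2"
          using True z h[of j] nb norm_triangle_ineq[of x "z *\<^sub>R b"] by simp
        then have "\<bar>?D (x + z *\<^sub>R b)\<bar> \<le> M" by (rule M)
        then show ?thesis using z True h[of j] by (simp add: q_def less_imp_neq[symmetric])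
      next
        case False
        have "norm x \<le> norm (x + h j *\<^sub>R b) + h j"
          using norm_triangle_ineq4[of "x + h j *\<^sub>R b" "h j *\<^sub>R b"] nb h[of j] by simp
        then have "x \<notin> K" "x + h j *\<^sub>R b \<notin> K" using False R h[of j] by force+
        then show ?thesis using K(2) False by (simp add: q_def)
      qed
    qed
  qed
  then show ?thesis unfolding q0 by (simp add: LIMSEQ_const_iff)
qed

lemma integration_by_parts_test:
  assumes \<Omega>: "open \<Omega>" and b: "b \<in> Basis" and \<psi>: "\<psi> \<in> test_functions \<Omega>" and \<eta>: "\<eta> \<in> test_functions \<Omega>"
  shows "L2_inner \<Omega> \<psi> (partials [b] \<eta>) = - L2_inner \<Omega> (partials [b] \<psi>) \<eta>"
proof -
  note K = test_function_support[OF \<psi>]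
  let ?p = "\<lambda>x. \<psi> x * \<eta> x"
  let ?D = "\<lambda>x. \<psi> x * partials [b] \<eta> x + partials [b] \<psi> x * \<eta> x"
  note s = test_function_smooth[OF \<psi>] test_function_smooth[OF \<eta>]
  note d = test_function_partial[OF \<psi> b] test_function_partial[OF \<eta> b]
  note L = test_function_L2[OF \<Omega>]
  have D: "frechet_derivative ?p (at x) b = ?D x" for x
  proof -
    have "(?p has_derivative (\<lambda>h. \<psi> x * frechet_derivative \<eta> (at x) h + frechet_derivative \<psi> (at x) h * \<eta> x)) (at x)"
      using s frechet_derivative_works by (intro has_derivative_mult) blast+
    then show ?thesis
      by (subst frechet_derivative_at[symmetric]) (assumption, simp only: partials_single)
  qed
  have cD: "continuous_on UNIV ?D"
    using s test_function_smooth(2)[OF d(1)] test_function_smooth(2)[OF d(2)]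
    by (intro continuous_intros)
  have D0: "?D x = 0" if "x \<notin> closure {x. \<psi> x \<noteq> 0}" for x
    using partial_vanishes[OF that] not_in_support[OF that] by simp
  have p0: "?p x = 0" if "x \<notin> closure {x. \<psi> x \<noteq> 0}" for x
    using not_in_support[OF that] by simp
  have "0 = (\<integral>x. frechet_derivative ?p (at x) b \<partial>lborel)"
  proof (rule integral_partial_zero[OF _ b _ K(1) p0, symmetric])
    show "?p differentiable (at x)" for x using s by (intro differentiable_mult)
    show "continuous_on UNIV (\<lambda>x. frechet_derivative ?p (at x) b)" unfolding D by (rule cD)
  qed
  also have "\<dots> = (\<integral>x. ?D x \<partial>lebesgue_on \<Omega>)"
    unfolding D by (rule integral_compact_support(2)[OF \<Omega> cD K D0, symmetric])
  also have "\<dots> = L2_inner \<Omega> \<psi> (partials [b] \<eta>) + L2_inner \<Omega> (partials [b] \<psi>) \<eta>"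
    unfolding L2_inner_def using d \<psi> \<eta>
    by (intro Bochner_Integration.integral_add L2_mult_integrable L) auto
  finally show ?thesis by simp
qed

section \<open>The Dirichlet Laplacian is symmetric\<close>

lemma finite_multi_indices: "finite (multi_indices m :: 'a::euclidean_space multiset set)"
proof (rule finite_subset)
  show "finite (mset ` {bs :: 'a list. set bs \<subseteq> Basis \<and> length bs \<le> m})"
    by (intro finite_imageI finite_lists_length_le) simp
  show "(multi_indices m :: 'a multiset set) \<subseteq> mset ` {bs. set bs \<subseteq> Basis \<and> length bs \<le> m}"
  proof
    fix \<alpha> :: "'a multiset" assume "\<alpha> \<in> multi_indices m"
    moreover obtain bs where "\<alpha> = mset bs" using ex_mset by metis
    ultimately show "\<alpha> \<in> mset ` {bs. set bs \<subseteq> Basis \<and> length bs \<le> m}"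
      by (auto simp: multi_indices_def)
  qed
qed

lemma weak_deriv_norm_le_sobolev_norm:
  "\<alpha> \<in> multi_indices m \<Longrightarrow> L2_norm \<Omega> (weak_deriv \<Omega> \<alpha> f) \<le> sobolev_norm m \<Omega> f"
  unfolding sobolev_norm_def
  by (rule member_le_sum[OF _ L2_norm_nonneg finite_multi_indices])

lemma L2_norm_le_sobolev_norm: "L2_norm \<Omega> f \<le> sobolev_norm m \<Omega> f"
  using weak_deriv_norm_le_sobolev_norm[of "{#}" m \<Omega> f] by (simp add: multi_indices_def weak_deriv_def)

lemma weak_deriv_spec:
  assumes "g \<in> L2 \<Omega>" "is_weak_deriv \<Omega> \<alpha> f g" "\<alpha> \<noteq> {#}"
  shows "weak_deriv \<Omega> \<alpha> f \<in> L2 \<Omega>" "is_weak_deriv \<Omega> \<alpha> f (weak_deriv \<Omega> \<alpha> f)"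
  using someI_ex[of "\<lambda>g. g \<in> L2 \<Omega> \<and> is_weak_deriv \<Omega> \<alpha> f g"] assms unfolding weak_deriv_def by auto

lemma sobolev_weak_deriv:
  assumes "f \<in> sobolev m \<Omega>" "\<alpha> \<in> multi_indices m" "\<alpha> \<noteq> {#}"
  shows "weak_deriv \<Omega> \<alpha> f \<in> L2 \<Omega>" "is_weak_deriv \<Omega> \<alpha> f (weak_deriv \<Omega> \<alpha> f)"
  using assms weak_deriv_spec unfolding sobolev_def by blast+

lemma weak_deriv_first:
  assumes "is_weak_deriv \<Omega> {#b#} f g" "\<eta> \<in> test_functions \<Omega>"
  shows "L2_inner \<Omega> f (partials [b] \<eta>) = - L2_inner \<Omega> g \<eta>"
  using assms unfolding is_weak_deriv_def by (force dest: bspec[of _ _ \<eta>] spec[of _ "[b]"])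

lemma weak_deriv_second:
  assumes "is_weak_deriv \<Omega> {#b, b#} f g" "\<eta> \<in> test_functions \<Omega>"
  shows "L2_inner \<Omega> f (partials [b] (partials [b] \<eta>)) = L2_inner \<Omega> g \<eta>"
  using assms partials_append[of "[b]" b \<eta>]
  unfolding is_weak_deriv_def by (force dest: bspec[of _ _ \<eta>] spec[of _ "[b, b]"])

lemma multi_indices_first: "b \<in> Basis \<Longrightarrow> {#b#} \<in> multi_indices m \<longleftrightarrow> 1 \<le> m"
  by (simp add: multi_indices_def)

lemma multi_indices_second: "b \<in> Basis \<Longrightarrow> {#b, b#} \<in> multi_indices m \<longleftrightarrow> 2 \<le> m"
  by (simp add: multi_indices_def numeral_2_eq_2)

lemma laplacian_L2: "f \<in> sobolev 2 \<Omega> \<Longrightarrow> laplacian \<Omega> f \<in> L2 \<Omega>"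
  unfolding laplacian_def[abs_def]
  by (intro L2_sum sobolev_weak_deriv(1)) (auto simp: multi_indices_second)

lemma laplacian_norm_le_sobolev_norm:
  fixes \<Omega> :: "'a::euclidean_space set"
  assumes "f \<in> sobolev 2 \<Omega>"
  shows "L2_norm \<Omega> (laplacian \<Omega> f) \<le> sobolev_norm 2 \<Omega> f"
proof -
  let ?dd = "\<lambda>b::'a. {#b, b#}"
  have inj: "inj_on ?dd Basis"
    by (rule inj_onI) (drule arg_cong[where f = set_mset], simp)
  have "L2_norm \<Omega> (laplacian \<Omega> f) \<le> (\<Sum>b\<in>Basis. L2_norm \<Omega> (weak_deriv \<Omega> (?dd b) f))"
    unfolding laplacian_def[abs_def]
    by (intro L2_norm_sum sobolev_weak_deriv(1)[OF assms]) (auto simp: multi_indices_second)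
  also have "\<dots> = (\<Sum>\<alpha>\<in>?dd ` Basis. L2_norm \<Omega> (weak_deriv \<Omega> \<alpha> f))"
    by (simp add: sum.reindex[OF inj])
  also have "\<dots> \<le> sobolev_norm 2 \<Omega> f"
    unfolding sobolev_norm_def
    by (rule sum_mono2[OF finite_multi_indices]) (auto simp: multi_indices_second L2_norm_nonneg)
  finally show ?thesis .
qed

text \<open>The fundamental lemma of the calculus of variations comes for free here: the eigenfunctions lie in
\<open>H10 \<Omega>\<close>, the closure of the test functions, and span \<open>L2 \<Omega>\<close>, so the test functions are dense.\<close>

lemma dirichlet_eigensystem_separates:
  assumes \<Omega>: "open \<Omega>" and eigen: "dirichlet_eigensystem \<Omega> lam \<phi>"
    and g: "g \<in> L2 \<Omega>" "\<And>\<eta>. \<eta> \<in> test_functions \<Omega> \<Longrightarrow> L2_inner \<Omega> g \<eta> = 0"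
  shows "L2_norm \<Omega> g = 0"
proof -
  have basis: "L2_orthonormal_basis \<Omega> \<phi>" and dom: "\<And>n. \<phi> n \<in> laplacian_domain \<Omega>"
    using eigen unfolding dirichlet_eigensystem_def by auto
  have "L2_inner \<Omega> g (\<phi> n) = 0" for n
  proof -
    have \<phi>: "\<phi> n \<in> L2 \<Omega>" using basis unfolding L2_orthonormal_basis_def by auto
    have "\<bar>L2_inner \<Omega> g (\<phi> n)\<bar> \<le> 0 + e" if e: "e > 0" for e
    proof -
      define d where "d = e / (L2_norm \<Omega> g + 1)"
      have p: "L2_norm \<Omega> g + 1 > 0" using L2_norm_nonneg[of \<Omega> g] by linarith
      have "d > 0" using e p by (simp add: d_def)
      then obtain \<psi> where \<psi>: "\<psi> \<in> test_functions \<Omega>" "sobolev_norm 1 \<Omega> (\<lambda>x. \<phi> n x - \<psi> x) < d"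
        using dom[of n] unfolding laplacian_domain_def H10_def by auto
      note \<psi>L = test_function_L2[OF \<Omega> \<psi>(1)]
      have "L2_inner \<Omega> g (\<phi> n) = L2_inner \<Omega> g (\<lambda>x. \<phi> n x - \<psi> x)"
        using g(2)[OF \<psi>(1)] by (simp add: L2_inner_diff_right[OF \<phi> \<psi>L g(1)])
      then have "\<bar>L2_inner \<Omega> g (\<phi> n)\<bar> \<le> L2_norm \<Omega> g * L2_norm \<Omega> (\<lambda>x. \<phi> n x - \<psi> x)"
        using L2_Cauchy_Schwarz[OF g(1) L2_diff[OF \<phi> \<psi>L]] by simp
      also have "\<dots> \<le> (L2_norm \<Omega> g + 1) * d"
        using \<psi>(2) L2_norm_le_sobolev_norm[of \<Omega> "\<lambda>x. \<phi> n x - \<psi> x" 1] L2_norm_nonneg p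
        by (intro mult_mono) auto
      also have "\<dots> = e" using p by (simp add: d_def)
      finally show ?thesis by simp
    qed
    then have "\<bar>L2_inner \<Omega> g (\<phi> n)\<bar> \<le> 0" by (rule field_le_epsilon)
    then show ?thesis by simp
  qed
  then have "(\<lambda>N::nat. L2_norm \<Omega> g) \<longlonglongrightarrow> 0"
    using basis g(1) unfolding L2_orthonormal_basis_def by fastforce
  then show ?thesis by (simp add: LIMSEQ_const_iff)
qed

text \<open>For a test function \<open>\<psi>\<close> in place of \<open>g\<close> this is the definition of weak derivatives, applied to the
second derivatives of \<open>f\<close> with \<open>\<psi>\<close> and to the first ones with the derivatives of \<open>\<psi>\<close>. To pass to the
limit, the chosen weak derivative of \<open>g - \<psi>\<close>, whose norm is small, has to agree with the difference
of the weak derivative of \<open>g\<close> and the classical one of \<open>\<psi>\<close>; this is where integration by parts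
and uniqueness of weak derivatives are needed.\<close>

lemma laplacian_green:
  fixes \<Omega> :: "'a::euclidean_space set"
  assumes \<Omega>: "open \<Omega>" and eigen: "dirichlet_eigensystem \<Omega> lam \<phi>"
    and f: "f \<in> sobolev 2 \<Omega>" and g: "g \<in> H10 \<Omega>"
  shows "L2_inner \<Omega> (laplacian \<Omega> f) g =
           - (\<Sum>b\<in>Basis. L2_inner \<Omega> (weak_deriv \<Omega> {#b#} f) (weak_deriv \<Omega> {#b#} g))"
proof -
  let ?df = "\<lambda>b. weak_deriv \<Omega> {#b#} f" and ?dg = "\<lambda>b. weak_deriv \<Omega> {#b#} g"
  have g1: "g \<in> sobolev 1 \<Omega>" "g \<in> L2 \<Omega>" using g by (auto simp: H10_def sobolev_def)
  have fd: "?df b \<in> L2 \<Omega>" "is_weak_deriv \<Omega> {#b#} f (?df b)" if "b \<in> Basis" for b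
    using sobolev_weak_deriv[OF f, of "{#b#}"] that by (auto simp: multi_indices_first)
  have fdd: "weak_deriv \<Omega> {#b, b#} f \<in> L2 \<Omega>" "is_weak_deriv \<Omega> {#b, b#} f (weak_deriv \<Omega> {#b, b#} f)"
    if "b \<in> Basis" for b
    using sobolev_weak_deriv[OF f, of "{#b, b#}"] that by (auto simp: multi_indices_second)
  have gd: "?dg b \<in> L2 \<Omega>" "is_weak_deriv \<Omega> {#b#} g (?dg b)" if "b \<in> Basis" for b
    using sobolev_weak_deriv[OF g1(1), of "{#b#}"] that by (auto simp: multi_indices_first)
  have Lf: "laplacian \<Omega> f \<in> L2 \<Omega>" by (rule laplacian_L2[OF f])
  have test: "L2_inner \<Omega> (laplacian \<Omega> f) \<psi> = - (\<Sum>b\<in>Basis. L2_inner \<Omega> (?df b) (partials [b] \<psi>))"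
    if \<psi>: "\<psi> \<in> test_functions \<Omega>" for \<psi>
  proof -
    have "L2_inner \<Omega> (laplacian \<Omega> f) \<psi> = (\<Sum>b\<in>Basis. L2_inner \<Omega> (weak_deriv \<Omega> {#b, b#} f) \<psi>)"
      unfolding laplacian_def[abs_def] by (rule L2_inner_sum[OF fdd(1) test_function_L2[OF \<Omega> \<psi>]])
    also have "\<dots> = (\<Sum>b\<in>Basis. - L2_inner \<Omega> (?df b) (partials [b] \<psi>))"
      using weak_deriv_second[OF fdd(2) \<psi>] weak_deriv_first[OF fd(2) test_function_partial[OF \<psi>]]
      by (intro sum.cong) auto
    finally show ?thesis by (simp add: sum_negf)
  qed
  define c where "c = L2_norm \<Omega> (laplacian \<Omega> f) + (\<Sum>b\<in>Basis. L2_norm \<Omega> (?df b))"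
  have c: "c \<ge> 0" unfolding c_def by (intro add_nonneg_nonneg sum_nonneg L2_norm_nonneg)
  define X where "X = L2_inner \<Omega> (laplacian \<Omega> f) g + (\<Sum>b\<in>Basis. L2_inner \<Omega> (?df b) (?dg b))"
  have "\<bar>X\<bar> \<le> 0 + e" if e: "e > 0" for e
  proof -
    define d where "d = e / (c + 1)"
    have "d > 0" using e c by (simp add: d_def)
    then obtain \<psi> where \<psi>: "\<psi> \<in> test_functions \<Omega>" "sobolev_norm 1 \<Omega> (\<lambda>x. g x - \<psi> x) < d"
      using g unfolding H10_def by auto
    note \<psi>L = test_function_L2[OF \<Omega> \<psi>(1)]
    note \<psi>d = test_function_L2[OF \<Omega> test_function_partial[OF \<psi>(1)]]
    have close: "L2_norm \<Omega> (\<lambda>x. ?dg b x - partials [b] \<psi> x) \<le> d" if b: "b \<in> Basis" for b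
    proof -
      let ?u = "\<lambda>x. ?dg b x - partials [b] \<psi> x" and ?v = "weak_deriv \<Omega> {#b#} (\<lambda>x. g x - \<psi> x)"
      have u: "?u \<in> L2 \<Omega>" by (intro L2_diff gd \<psi>d b)
      have "is_weak_deriv \<Omega> {#b#} (\<lambda>x. g x - \<psi> x) ?u"
        unfolding is_weak_deriv_def
      proof (intro ballI allI impI)
        fix \<eta> bs assume \<eta>: "\<eta> \<in> test_functions \<Omega>" and "mset bs = {#b#}"
        then have bs: "bs = [b]" by simp
        have "L2_inner \<Omega> (\<lambda>x. g x - \<psi> x) (partials [b] \<eta>) = - L2_inner \<Omega> (?dg b) \<eta> + L2_inner \<Omega> (partials [b] \<psi>) \<eta>"
          using weak_deriv_first[OF gd(2)[OF b] \<eta>] integration_by_parts_test[OF \<Omega> b \<psi>(1) \<eta>]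
            L2_inner_diff[OF g1(2) \<psi>L test_function_L2[OF \<Omega> test_function_partial[OF \<eta> b]]] by simp
        also have "\<dots> = - L2_inner \<Omega> ?u \<eta>"
          using L2_inner_diff[OF gd(1)[OF b] \<psi>d[OF b] test_function_L2[OF \<Omega> \<eta>]] by simp
        finally show "L2_inner \<Omega> (\<lambda>x. g x - \<psi> x) (partials bs \<eta>) = (- 1) ^ size {#b#} * L2_inner \<Omega> ?u \<eta>"
          by (simp add: bs)
      qed
      note uw = this
      have v: "?v \<in> L2 \<Omega>" "is_weak_deriv \<Omega> {#b#} (\<lambda>x. g x - \<psi> x) ?v"
        using weak_deriv_spec[OF u uw] by auto
      have "L2_norm \<Omega> (\<lambda>x. ?u x - ?v x) = 0"
      proof (rule dirichlet_eigensystem_separates[OF \<Omega> eigen L2_diff[OF u v(1)]])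
        fix \<eta> assume \<eta>: "\<eta> \<in> test_functions \<Omega>"
        show "L2_inner \<Omega> (\<lambda>x. ?u x - ?v x) \<eta> = 0"
          using weak_deriv_first[OF uw \<eta>] weak_deriv_first[OF v(2) \<eta>]
            L2_inner_diff[OF u v(1) test_function_L2[OF \<Omega> \<eta>]] by simp
      qed
      moreover have "L2_norm \<Omega> ?u \<le> L2_norm \<Omega> (\<lambda>x. ?u x - ?v x) + L2_norm \<Omega> ?v"
        using L2_norm_triangle[OF L2_diff[OF u v(1)] v(1)] by simp
      moreover have "L2_norm \<Omega> ?v \<le> d"
        using weak_deriv_norm_le_sobolev_norm[of "{#b#}" 1 \<Omega> "\<lambda>x. g x - \<psi> x"] \<psi>(2) b
        by (simp add: multi_indices_first)
      ultimately show ?thesis by linarith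
    qed
    have "X = L2_inner \<Omega> (laplacian \<Omega> f) (\<lambda>x. g x - \<psi> x)
        + (\<Sum>b\<in>Basis. L2_inner \<Omega> (?df b) (\<lambda>x. ?dg b x - partials [b] \<psi> x))"
      using test[OF \<psi>(1)] L2_inner_diff_right[OF g1(2) \<psi>L Lf]
      by (simp add: X_def L2_inner_diff_right fd gd \<psi>d sum_subtractf)
    also have "\<bar>\<dots>\<bar> \<le> \<bar>L2_inner \<Omega> (laplacian \<Omega> f) (\<lambda>x. g x - \<psi> x)\<bar>
        + (\<Sum>b\<in>Basis. \<bar>L2_inner \<Omega> (?df b) (\<lambda>x. ?dg b x - partials [b] \<psi> x)\<bar>)"
      by (intro order_trans[OF abs_triangle_ineq] add_mono sum_abs order_refl)
    also have "\<dots> \<le> L2_norm \<Omega> (laplacian \<Omega> f) * d + (\<Sum>b\<in>Basis. L2_norm \<Omega> (?df b) * d)"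
    proof (intro add_mono sum_mono)
      have "L2_norm \<Omega> (\<lambda>x. g x - \<psi> x) \<le> d"
        using L2_norm_le_sobolev_norm[of \<Omega> "\<lambda>x. g x - \<psi> x" 1] \<psi>(2) by simp
      then show "\<bar>L2_inner \<Omega> (laplacian \<Omega> f) (\<lambda>x. g x - \<psi> x)\<bar> \<le> L2_norm \<Omega> (laplacian \<Omega> f) * d"
        by (intro order_trans[OF L2_Cauchy_Schwarz[OF Lf L2_diff[OF g1(2) \<psi>L]]] mult_left_mono L2_norm_nonneg)
      fix b :: 'a assume b: "b \<in> Basis"
      show "\<bar>L2_inner \<Omega> (?df b) (\<lambda>x. ?dg b x - partials [b] \<psi> x)\<bar> \<le> L2_norm \<Omega> (?df b) * d"
        by (intro order_trans[OF L2_Cauchy_Schwarz[OF fd(1)[OF b] L2_diff[OF gd(1)[OF b] \<psi>d[OF b]]]]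
            mult_left_mono L2_norm_nonneg close b)
    qed
    also have "\<dots> = c * d" by (simp add: c_def distrib_right sum_distrib_right)
    also have "\<dots> \<le> (c + 1) * d" using \<open>d > 0\<close> by (simp add: distrib_right)
    also have "\<dots> = e" using c by (simp add: d_def)
    finally show ?thesis by simp
  qed
  then have "\<bar>X\<bar> \<le> 0" by (rule field_le_epsilon)
  then show ?thesis by (simp add: X_def)
qed

lemma laplacian_symmetric:
  assumes "open \<Omega>" "dirichlet_eigensystem \<Omega> lam \<phi>"
    and "f \<in> laplacian_domain \<Omega>" "g \<in> laplacian_domain \<Omega>"
  shows "L2_inner \<Omega> (laplacian \<Omega> f) g = L2_inner \<Omega> (laplacian \<Omega> g) f"
  using laplacian_green[OF assms(1,2), of f g] laplacian_green[OF assms(1,2), of g f] assms(3,4)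
  by (simp add: laplacian_domain_def L2_inner_commute[of \<Omega> "weak_deriv \<Omega> _ g"])

lemma laplacian_eigen_coefficient:
  assumes \<Omega>: "open \<Omega>" and eigen: "dirichlet_eigensystem \<Omega> lam \<phi>" and f: "f \<in> laplacian_domain \<Omega>"
  shows "L2_inner \<Omega> (laplacian \<Omega> f) (\<phi> n) = - lam n * L2_inner \<Omega> f (\<phi> n)"
proof -
  have \<phi>: "\<phi> n \<in> laplacian_domain \<Omega>" "AE x in lebesgue_on \<Omega>. laplacian \<Omega> (\<phi> n) x = - lam n * \<phi> n x"
    "\<phi> n \<in> L2 \<Omega>"
    using eigen unfolding dirichlet_eigensystem_def L2_orthonormal_basis_def by auto
  have "L2_inner \<Omega> (laplacian \<Omega> f) (\<phi> n) = L2_inner \<Omega> (laplacian \<Omega> (\<phi> n)) f"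
    by (rule laplacian_symmetric[OF \<Omega> eigen f \<phi>(1)])
  also have "\<dots> = L2_inner \<Omega> (\<lambda>x. - lam n * \<phi> n x) f"
    using f \<phi> by (intro L2_inner_cong_AE laplacian_L2 L2_scale) (auto simp: laplacian_domain_def sobolev_def)
  also have "\<dots> = - lam n * L2_inner \<Omega> f (\<phi> n)"
    by (simp only: L2_inner_scale L2_inner_commute[of \<Omega> f])
  finally show ?thesis .
qed

section \<open>Orthonormal bases\<close>

lemma L2_norm_orthonormal_remainder:
  assumes basis: "L2_orthonormal_basis \<Omega> \<phi>" and g: "g \<in> L2 \<Omega>"
  shows "(L2_norm \<Omega> (\<lambda>x. g x - (\<Sum>n<N. L2_inner \<Omega> g (\<phi> n) * \<phi> n x)))\<^sup>2
           = (L2_norm \<Omega> g)\<^sup>2 - (\<Sum>n<N. (L2_inner \<Omega> g (\<phi> n))\<^sup>2)"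
proof -
  let ?c = "\<lambda>n. L2_inner \<Omega> g (\<phi> n)"
  let ?S = "\<lambda>x. \<Sum>n<N. ?c n * \<phi> n x"
  have \<phi>: "\<And>n. \<phi> n \<in> L2 \<Omega>" and on: "\<And>m n. L2_inner \<Omega> (\<phi> m) (\<phi> n) = (if m = n then 1 else 0)"
    using basis unfolding L2_orthonormal_basis_def by auto
  have S: "?S \<in> L2 \<Omega>" by (intro L2_sum L2_scale \<phi>)
  have Sh: "L2_inner \<Omega> ?S h = (\<Sum>n<N. ?c n * L2_inner \<Omega> (\<phi> n) h)" if "h \<in> L2 \<Omega>" for h
    using that by (subst L2_inner_sum) (auto intro: L2_scale \<phi> simp: L2_inner_scale)
  have S\<phi>: "L2_inner \<Omega> (\<phi> m) ?S = ?c m" if "m < N" for m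
    using that by (simp add: L2_inner_commute[of \<Omega> "\<phi> m"] Sh[OF \<phi>] on if_distrib[of "(*) _"] cong: if_cong)
  have SS: "L2_inner \<Omega> ?S ?S = (\<Sum>n<N. (?c n)\<^sup>2)"
    by (subst Sh[OF S]) (simp add: S\<phi> power2_eq_square)
  have Sg: "L2_inner \<Omega> ?S g = (\<Sum>n<N. (?c n)\<^sup>2)"
    by (subst Sh[OF g]) (simp add: L2_inner_commute[of \<Omega> "\<phi> _" g] power2_eq_square)
  have "L2_inner \<Omega> (\<lambda>x. g x - ?S x) (\<lambda>x. g x - ?S x)
      = (L2_inner \<Omega> g g - L2_inner \<Omega> g ?S) - (L2_inner \<Omega> ?S g - L2_inner \<Omega> ?S ?S)"
    by (simp only: L2_inner_diff[OF g S L2_diff[OF g S]] L2_inner_diff_right[OF g S g] L2_inner_diff_right[OF g S S])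
  then show ?thesis
    using SS Sg L2_inner_commute[of \<Omega> g ?S] by (simp add: L2_norm_sq)
qed

lemma L2_bessel:
  assumes "L2_orthonormal_basis \<Omega> \<phi>" "g \<in> L2 \<Omega>"
  shows "(\<Sum>n<N. (L2_inner \<Omega> g (\<phi> n))\<^sup>2) \<le> (L2_norm \<Omega> g)\<^sup>2"
  using L2_norm_orthonormal_remainder[OF assms, of N]
    zero_le_power2[of "L2_norm \<Omega> (\<lambda>x. g x - (\<Sum>n<N. L2_inner \<Omega> g (\<phi> n) * \<phi> n x))"] by linarith

lemma L2_parseval:
  assumes "L2_orthonormal_basis \<Omega> \<phi>" "g \<in> L2 \<Omega>"
  shows "(\<lambda>N. \<Sum>n<N. (L2_inner \<Omega> g (\<phi> n))\<^sup>2) \<longlonglongrightarrow> (L2_norm \<Omega> g)\<^sup>2"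
proof -
  have "(\<lambda>N. L2_norm \<Omega> (\<lambda>x. g x - (\<Sum>n<N. L2_inner \<Omega> g (\<phi> n) * \<phi> n x))) \<longlonglongrightarrow> 0"
    using assms unfolding L2_orthonormal_basis_def by auto
  from tendsto_diff[OF tendsto_const[of "(L2_norm \<Omega> g)\<^sup>2"] tendsto_power[OF this, of 2]]
  show ?thesis by (simp add: L2_norm_orthonormal_remainder[OF assms])
qed

lemma L2_norm_basis:
  assumes "L2_orthonormal_basis \<Omega> \<phi>"
  shows "L2_norm \<Omega> (\<phi> n) = 1"
  using assms by (simp add: L2_norm_def L2_orthonormal_basis_def)

section \<open>Stability of the inverse problem\<close>

text \<open>Pairing the equation with an eigenfunction and moving the Laplacian to it turns the problem into
the scalar relaxation equation.\<close>

lemma solution_coefficient: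
  assumes k: "admissible_kernel k" and v: "impulse_response k v" and T: "T > 0"
    and \<Omega>: "open \<Omega>" and eigen: "dirichlet_eigensystem \<Omega> lam \<phi>" and lam: "lam n > 0"
    and q: "continuous_on {0..T} q" and f: "f \<in> L2 \<Omega>" and h: "h \<in> L2 \<Omega>"
    and sol: "solves_inverse_problem k \<Omega> T q h f u"
  shows "L2_inner \<Omega> h (\<phi> n) = L2_inner \<Omega> f (\<phi> n) * convol (\<lambda>t. v t (lam n)) q T"
proof -
  define w where "w t = L2_inner \<Omega> (\<lambda>x. u x t) (\<phi> n)" for t
  let ?fn = "L2_inner \<Omega> f (\<phi> n)"
  have basis: "L2_orthonormal_basis \<Omega> \<phi>" using eigen unfolding dirichlet_eigensystem_def by auto
  then have \<phi>: "\<phi> n \<in> L2 \<Omega>" unfolding L2_orthonormal_basis_def by auto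
  have u: "(\<lambda>x. u x t) \<in> L2 \<Omega>"
    and uc: "((\<lambda>r. L2_norm \<Omega> (\<lambda>x. u x r - u x t)) \<longlongrightarrow> 0) (at t within {0..T})" if "t \<in> {0..T}" for t
    using sol that unfolding solves_inverse_problem_def solves_ibvp_def by auto
  have ud: "(\<lambda>x. u x t) \<in> laplacian_domain \<Omega>"
    and conv: "convol k w differentiable (at t)"
    and gen: "gen_deriv k w t = L2_inner \<Omega> (\<lambda>x. laplacian \<Omega> (\<lambda>y. u y t) x + f x * q t) (\<phi> n)"
    if "t \<in> {0<..<T}" for t
    using sol that \<phi> unfolding solves_inverse_problem_def solves_ibvp_def w_def[abs_def] by auto
  have u0: "AE x in lebesgue_on \<Omega>. u x 0 = 0" and uT: "AE x in lebesgue_on \<Omega>. u x T = h x"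
    using sol unfolding solves_inverse_problem_def solves_ibvp_def by auto
  have w0: "w 0 = 0"
  proof -
    have "w 0 = L2_inner \<Omega> (\<lambda>x. 0) (\<phi> n)"
      unfolding w_def using u[of 0] T u0 by (intro L2_inner_cong_AE L2_zero \<phi>) auto
    then show ?thesis by (simp add: L2_inner_def)
  qed
  have wT: "w T = L2_inner \<Omega> h (\<phi> n)"
    unfolding w_def using u[of T] T uT by (intro L2_inner_cong_AE h \<phi>) auto
  have "continuous_on {0..T} w"
    unfolding continuous_on_def
  proof
    fix t assume t: "t \<in> {0..T}"
    have "norm (w r - w t) \<le> L2_norm \<Omega> (\<lambda>x. u x r - u x t)" if "r \<in> {0..T}" for r
      using L2_Cauchy_Schwarz[OF L2_diff[OF u[OF that] u[OF t]] \<phi>] L2_norm_basis[OF basis]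
      by (simp add: w_def L2_inner_diff[OF u[OF that] u[OF t] \<phi>])
    then have "eventually (\<lambda>r. norm (w r - w t) \<le> L2_norm \<Omega> (\<lambda>x. u x r - u x t)) (at t within {0..T})"
      by (simp add: eventually_at_filter)
    then have "((\<lambda>r. w r - w t) \<longlongrightarrow> 0) (at t within {0..T})"
      by (rule Lim_null_comparison[OF _ uc[OF t]])
    then show "(w \<longlongrightarrow> w t) (at t within {0..T})" by (rule LIM_zero_cancel)
  qed
  moreover have "deriv (convol k w) t + lam n * w t = ?fn * q t" if t: "t \<in> {0<..<T}" for t
  proof -
    have Lu: "laplacian \<Omega> (\<lambda>y. u y t) \<in> L2 \<Omega>"
      using ud[OF t] by (intro laplacian_L2) (simp add: laplacian_domain_def)
    have "L2_inner \<Omega> (\<lambda>x. laplacian \<Omega> (\<lambda>y. u y t) x + q t * f x) (\<phi> n) = - lam n * w t + q t * ?fn"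
      unfolding L2_inner_add[OF Lu L2_scale[OF f] \<phi>] L2_inner_scale w_def
        laplacian_eigen_coefficient[OF \<Omega> eigen ud[OF t]] ..
    then have "gen_deriv k w t = - lam n * w t + q t * ?fn"
      using gen[OF t] by (simp add: mult.commute)
    then show ?thesis using w0 by (simp add: gen_deriv_def mult.commute)
  qed
  ultimately have "w T = convol (\<lambda>t. v t (lam n)) (\<lambda>t. ?fn * q t) T"
    by (intro relaxation_equation_solution[OF k v lam T _ w0 _ conv] continuous_intros q)
  also have "\<dots> = ?fn * convol (\<lambda>t. v t (lam n)) q T"
    unfolding convol_def set_lebesgue_integral_def
    by (subst Bochner_Integration.integral_mult_right_zero[symmetric])
       (intro Bochner_Integration.integral_cong refl, simp add: mult_ac)
  finally show ?thesis using wT by simp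
qed

text \<open>By the hypothesis, \<open>C\<close> times the square of the \<open>n\<close>-th coefficient of \<open>f\<close> is at most the product of
the moduli of the \<open>n\<close>-th coefficients of \<open>laplacian \<Omega> f\<close> and of \<open>h\<close>. Summation with the
Cauchy--Schwarz and Bessel inequalities yields the claim.\<close>

lemma spectral_interpolation:
  assumes \<Omega>: "open \<Omega>" and eigen: "dirichlet_eigensystem \<Omega> lam \<phi>" and C: "C > 0"
    and f: "f \<in> laplacian_domain \<Omega>" and h: "h \<in> L2 \<Omega>"
    and coeff: "\<And>n. C * \<bar>L2_inner \<Omega> f (\<phi> n)\<bar> \<le> lam n * \<bar>L2_inner \<Omega> h (\<phi> n)\<bar>"
  shows "C * (L2_norm \<Omega> f)\<^sup>2 \<le> L2_norm \<Omega> (laplacian \<Omega> f) * L2_norm \<Omega> h"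
proof -
  have basis: "L2_orthonormal_basis \<Omega> \<phi>" using eigen unfolding dirichlet_eigensystem_def by auto
  have fL: "f \<in> L2 \<Omega>" "laplacian \<Omega> f \<in> L2 \<Omega>"
    using f laplacian_L2 by (auto simp: laplacian_domain_def sobolev_def)
  let ?f = "\<lambda>n. L2_inner \<Omega> f (\<phi> n)" and ?h = "\<lambda>n. L2_inner \<Omega> h (\<phi> n)"
  let ?d = "\<lambda>n. L2_inner \<Omega> (laplacian \<Omega> f) (\<phi> n)"
  have "(\<Sum>n<N. (?f n)\<^sup>2) \<le> L2_norm \<Omega> (laplacian \<Omega> f) * L2_norm \<Omega> h / C" for N
  proof -
    have "C * (?f n)\<^sup>2 \<le> \<bar>?d n\<bar> * \<bar>?h n\<bar>" for n
    proof -
      have "C * (?f n)\<^sup>2 = (C * \<bar>?f n\<bar>) * \<bar>?f n\<bar>" by (simp add: power2_eq_square)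
      also have "\<dots> \<le> (lam n * \<bar>?h n\<bar>) * \<bar>?f n\<bar>" by (intro mult_right_mono coeff) auto
      also have "\<dots> \<le> \<bar>lam n\<bar> * \<bar>?h n\<bar> * \<bar>?f n\<bar>" by (intro mult_right_mono) auto
      also have "\<dots> = \<bar>?d n\<bar> * \<bar>?h n\<bar>"
        by (simp add: laplacian_eigen_coefficient[OF \<Omega> eigen f] abs_mult mult_ac)
      finally show ?thesis .
    qed
    then have "(\<Sum>n<N. C * (?f n)\<^sup>2) \<le> (\<Sum>n<N. \<bar>?d n\<bar> * \<bar>?h n\<bar>)" by (rule sum_mono)
    also have "\<dots> \<le> L2_set ?d {..<N} * L2_set ?h {..<N}" by (rule L2_set_mult_ineq)
    also have "\<dots> \<le> L2_norm \<Omega> (laplacian \<Omega> f) * L2_norm \<Omega> h"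
      unfolding L2_set_def using L2_bessel[OF basis fL(2), of N] L2_bessel[OF basis h, of N]
      by (intro mult_mono real_le_lsqrt) (auto simp: L2_norm_nonneg sum_nonneg)
    finally show ?thesis using C by (simp add: sum_distrib_left[symmetric] pos_le_divide_eq mult.commute)
  qed
  then have "(L2_norm \<Omega> f)\<^sup>2 \<le> L2_norm \<Omega> (laplacian \<Omega> f) * L2_norm \<Omega> h / C"
    by (intro LIMSEQ_le_const2[OF L2_parseval[OF basis fL(1)]]) auto
  then show ?thesis using C by (simp add: pos_le_divide_eq mult.commute)
qed

theorem mainTheorem4:
  fixes k q :: "real \<Rightarrow> real"
    and \<Omega> :: "'a::euclidean_space set"
    and T q0 :: real
    and lam :: "nat \<Rightarrow> real"
    and \<phi> :: "nat \<Rightarrow> 'a \<Rightarrow> real"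
    and v :: "real \<Rightarrow> real \<Rightarrow> real"
    and Q :: "nat \<Rightarrow> real"
  assumes kernel: "admissible_kernel k"
    and domain: "smooth_bounded_domain \<Omega>"
    and eigen: "dirichlet_eigensystem \<Omega> lam \<phi>"
    and impulse: "impulse_response k v"
    and T: "T > 0"
    and q: "continuous_on {0..T} q" "q0 > 0" "\<forall>t\<in>{0..T}. q t \<ge> q0"
    and Q: "\<forall>n. Q n = (LINT \<tau>:{0..T}|lebesgue. v (T - \<tau>) (lam n) * q \<tau>)"
  shows "(\<exists>C>0. \<forall>n. Q n \<ge> C / lam n) \<and>
         (\<forall>C>0. (\<forall>n. Q n \<ge> C / lam n) \<longrightarrow>
           (\<forall>f u h E. f \<in> laplacian_domain \<Omega> \<longrightarrow> h \<in> L2 \<Omega> \<longrightarrow>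
              solves_inverse_problem k \<Omega> T q h f u \<longrightarrow>
              sobolev_norm 2 \<Omega> f \<le> E \<longrightarrow>
              L2_norm \<Omega> f \<le> C powr (- 1 / 2) * E powr (1 / 2) * L2_norm \<Omega> h powr (1 / 2)))"
proof (intro conjI allI impI)
  have Qc: "Q n = convol (\<lambda>t. v t (lam n)) q T" for n using Q by (simp add: convol_def)
  have lam0: "lam 0 > 0" and lam_mono: "lam 0 \<le> lam n" for n
    using eigen unfolding dirichlet_eigensystem_def by (auto dest: incseqD)
  have lam_pos: "lam n > 0" for n using lam0 lam_mono[of n] by linarith
  show "\<exists>C>0. \<forall>n. Q n \<ge> C / lam n"
    using impulse_convol_uniform_lower_bound[OF kernel impulse lam0 T q(1,2)] q(3) lam_mono Qc by metis
  have open_\<Omega>: "open \<Omega>" using domain by (simp add: smooth_bounded_domain_def)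
  fix C E :: real and f h :: "'a \<Rightarrow> real" and u
  assume C: "C > 0" "\<forall>n. Q n \<ge> C / lam n" and f: "f \<in> laplacian_domain \<Omega>" and h: "h \<in> L2 \<Omega>"
    and sol: "solves_inverse_problem k \<Omega> T q h f u" and E: "sobolev_norm 2 \<Omega> f \<le> E"
  have fL: "f \<in> L2 \<Omega>" "f \<in> sobolev 2 \<Omega>" using f by (auto simp: laplacian_domain_def sobolev_def)
  have "C * \<bar>L2_inner \<Omega> f (\<phi> n)\<bar> \<le> lam n * \<bar>L2_inner \<Omega> h (\<phi> n)\<bar>" for n
  proof -
    have Qn: "C \<le> lam n * Q n" using C(2)[rule_format, of n] lam_pos[of n] by (simp add: pos_divide_le_eq mult.commute)
    then have "0 \<le> Q n" using C(1) lam_pos[of n] by (smt (verit) mult_pos_neg)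
    moreover have "C * \<bar>L2_inner \<Omega> f (\<phi> n)\<bar> \<le> lam n * Q n * \<bar>L2_inner \<Omega> f (\<phi> n)\<bar>"
      using Qn by (rule mult_right_mono) simp
    ultimately show ?thesis
      unfolding solution_coefficient[OF kernel impulse T open_\<Omega> eigen lam_pos q(1) fL(1) h sol] Qc[symmetric]
      by (simp add: abs_mult mult_ac)
  qed
  then have "C * (L2_norm \<Omega> f)\<^sup>2 \<le> L2_norm \<Omega> (laplacian \<Omega> f) * L2_norm \<Omega> h"
    by (rule spectral_interpolation[OF open_\<Omega> eigen C(1) f h])
  also have "\<dots> \<le> E * L2_norm \<Omega> h"
    using laplacian_norm_le_sobolev_norm[OF fL(2)] E by (intro mult_right_mono L2_norm_nonneg) linarith
  finally have "(L2_norm \<Omega> f)\<^sup>2 \<le> 1 / C * E * L2_norm \<Omega> h"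
    using C(1) by (simp add: field_simps)
  then have "L2_norm \<Omega> f \<le> sqrt (1 / C * E * L2_norm \<Omega> h)" by (rule real_le_rsqrt)
  moreover have "0 \<le> E" using L2_norm_nonneg L2_norm_le_sobolev_norm E by (metis order_trans)
  ultimately show "L2_norm \<Omega> f \<le> C powr (- 1 / 2) * E powr (1 / 2) * L2_norm \<Omega> h powr (1 / 2)"
    using C(1) L2_norm_nonneg[of \<Omega> h] powr_minus[of C "1 / 2"]
    by (simp add: powr_half_sqrt real_sqrt_mult real_sqrt_divide inverse_eq_divide)
qed

end
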